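(* Let $R$ and $M$ be graded rings, and $\theta\colon R\to M$ a graded ring homomorphism. View $M$ as a graded left $R$-module with scalar multiplication given by $\theta$. Assume that $R_0$ is noetherian, that every $R_i$ is finitely generated as left and as right $R_0$-module, and that every $M_i$ is finitely generated as left $R_0$-module. Similarly, let $R'$ and $M'$ be graded rings, and $\theta'\colon R'\to M'$ a graded ring homomorphism. View $M'$ as a graded left $R'$-module with scalar multiplication given by $\theta'$. Assume that $R'_0$ is noetherian, that every $R'_i$ is finitely generated as left and as right $R'_0$-module, and that every $M'_i$ is finitely generated as left $R'_0$-module. Assume that, for some nonnegative integer $n$, there are graded rng isomorphisms $\phi\colon R_{\ge n}\to R'_{\ge n}$ and $\psi\colon M_{\ge n}\to M'_{\ge n}$ such that $\psi\circ\theta_{\ge n}=\theta'_{\ge n}\circ\phi$, where $\theta_{\ge n}\colon R_{\ge n}\to M_{\ge n}$ and $\theta'_{\ge n}\colon R'_{\ge n}\to M'_{\ge n}$ are the restrictions of $\theta$ and $\theta'$. Then the following two conditions are equivalent. (i) $R$ is noetherian and $M$ is finitely generated as left $R$-module. (ii) $R'$ is noetherian and $M'$ is finitely generated as left $R'$-module.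
   Context: A graded ring is a ring (associative, with identity) of the form $R=\bigoplus_{i=0}^\infty R_i$ graded over the nonnegative integers. $R_{\ge n}=\bigoplus_{i\ge n}R_i$, a graded ideal of $R$. A rng is an object satisfying all the axioms of a ring except the existence of a multiplicative identity; a graded rng isomorphism is a degree-preserving additive and multiplicative bijection. Noetherian means left and right noetherian. *)

theory Defs
  imports "HOL-Algebra.Algebra"
begin

text \<open>
  Rings are those of the locale \<open>ring\<close>: associative, with identity, not assumed commutative
  and possibly zero.
\<close>

definition opposite_ring :: "('a, 'm) ring_scheme \<Rightarrow> ('a, 'm) ring_scheme" where
  "opposite_ring R = R\<lparr>monoid.mult := \<lambda>x y. y \<otimes>\<^bsub>R\<^esub> x\<rparr>"

text \<open>
  The locale \<open>module\<close> requires a commutative base ring, so only its record type is used here,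
  for left modules over an arbitrary ring. The fields \<open>mult\<close> and \<open>one\<close> of a module record
  play no role.
\<close>

definition module_via :: "('a \<Rightarrow> 'b) \<Rightarrow> ('b, 'n) ring_scheme \<Rightarrow> ('a, 'b) module" where
  "module_via \<theta> M =
    \<lparr>carrier = carrier M, monoid.mult = monoid.mult M, one = monoid.one M,
     ring.zero = ring.zero M, add = ring.add M,
     smult = (\<lambda>r m. \<theta> r \<otimes>\<^bsub>M\<^esub> m)\<rparr>"

definition left_regular :: "('a, 'm) ring_scheme \<Rightarrow> ('a, 'a) module" where
  "left_regular R = module_via id R"

definition fin_gen_left_module ::
    "('a, 'm) ring_scheme \<Rightarrow> ('a, 'b, 'n) module_scheme \<Rightarrow> bool" where
  "fin_gen_left_module R N \<longleftrightarrow>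
    (\<exists>S. finite S \<and> S \<subseteq> carrier N \<and>
         carrier N = {\<Oplus>\<^bsub>N\<^esub>s\<in>S. f s \<odot>\<^bsub>N\<^esub> s | f. f \<in> S \<rightarrow> carrier R})"

definition left_ideal :: "'a set \<Rightarrow> ('a, 'm) ring_scheme \<Rightarrow> bool" where
  "left_ideal I R \<longleftrightarrow>
    additive_subgroup I R \<and> (\<forall>r\<in>carrier R. \<forall>a\<in>I. r \<otimes>\<^bsub>R\<^esub> a \<in> I)"

definition left_noetherian :: "('a, 'm) ring_scheme \<Rightarrow> bool" where
  "left_noetherian R \<longleftrightarrow>
    (\<forall>I. left_ideal I R \<longrightarrow> fin_gen_left_module R ((left_regular R)\<lparr>carrier := I\<rparr>))"

text \<open>
  Right ideals and right modules are treated as left ones over the opposite ring. The library's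
  \<open>noetherian_ring\<close> concerns two-sided ideals only.
\<close>

definition noetherian :: "('a, 'm) ring_scheme \<Rightarrow> bool" where
  "noetherian R \<longleftrightarrow> left_noetherian R \<and> left_noetherian (opposite_ring R)"

text \<open>
  Internal grading: each element of \<open>R\<close> has exactly one decomposition into homogeneous
  components, almost all zero.
\<close>

locale graded_ring = ring R for R (structure) +
  fixes A :: "nat \<Rightarrow> 'a set"
  assumes component_subgroup: "additive_subgroup (A i) R"
    and decomposition: "x \<in> carrier R \<Longrightarrow>
      \<exists>!f. (\<forall>i. f i \<in> A i) \<and> finite {i. f i \<noteq> \<zero>} \<and> x = (\<Oplus>i\<in>{i. f i \<noteq> \<zero>}. f i)"
    and component_mult: "x \<in> A i \<Longrightarrow> y \<in> A j \<Longrightarrow> x \<otimes> y \<in> A (i + j)"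

definition graded_ring_hom ::
    "('a, 'm) ring_scheme \<Rightarrow> (nat \<Rightarrow> 'a set) \<Rightarrow> ('b, 'n) ring_scheme \<Rightarrow> (nat \<Rightarrow> 'b set) \<Rightarrow>
     ('a \<Rightarrow> 'b) set" where
  "graded_ring_hom R A S B = {h \<in> ring_hom R S. \<forall>i. h ` A i \<subseteq> B i}"

text \<open>The degree-zero subring.\<close>

definition degree_zero :: "('a, 'm) ring_scheme \<Rightarrow> (nat \<Rightarrow> 'a set) \<Rightarrow> ('a, 'm) ring_scheme" where
  "degree_zero R A = R\<lparr>carrier := A 0\<rparr>"

text \<open>
  The graded ideal \<open>R\<^sub>\<ge>\<^sub>n\<close>, the sum of the components of degree at least \<open>n\<close>. As a rng it has no
  distinguished identity: the field \<open>one\<close> of \<open>tail_rng\<close> plays no role.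
\<close>

definition tail :: "('a, 'm) ring_scheme \<Rightarrow> (nat \<Rightarrow> 'a set) \<Rightarrow> nat \<Rightarrow> 'a set" where
  "tail R A n = {\<Oplus>\<^bsub>R\<^esub>i\<in>F. f i | F f. finite F \<and> F \<subseteq> {n..} \<and> (\<forall>i\<in>F. f i \<in> A i)}"

definition tail_rng ::
    "('a, 'm) ring_scheme \<Rightarrow> (nat \<Rightarrow> 'a set) \<Rightarrow> nat \<Rightarrow> ('a, 'm) ring_scheme" where
  "tail_rng R A n = R\<lparr>carrier := tail R A n\<rparr>"

definition tail_component ::
    "('a, 'm) ring_scheme \<Rightarrow> (nat \<Rightarrow> 'a set) \<Rightarrow> nat \<Rightarrow> nat \<Rightarrow> 'a set" where
  "tail_component R A n i = (if n \<le> i then A i else {\<zero>\<^bsub>R\<^esub>})"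

text \<open>Unlike \<open>ring_iso\<close>, the following does not ask for preservation of \<open>one\<close>.\<close>

definition graded_rng_iso ::
    "('a, 'm) ring_scheme \<Rightarrow> (nat \<Rightarrow> 'a set) \<Rightarrow> ('b, 'n) ring_scheme \<Rightarrow> (nat \<Rightarrow> 'b set) \<Rightarrow>
     ('a \<Rightarrow> 'b) set" where
  "graded_rng_iso S A T B =
    {h. h \<in> hom S T \<and> h \<in> hom (add_monoid S) (add_monoid T) \<and>
        bij_betw h (carrier S) (carrier T) \<and> (\<forall>i. h ` A i \<subseteq> B i)}"

end

theory Submission
  imports Defs
begin

text \<open>
  Let \<open>J\<close> be a left ideal of \<open>R'\<close>. Its leading forms of degree at least \<open>n\<close>, pulled back along \<open>\<phi>\<close>,
  generate a left ideal of \<open>R\<close>, which is finitely generated and hence generated by the pulled back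
  leading forms of degree at most some \<open>N\<close>. In degrees at least \<open>N + n\<close> the coefficients that occur
  lie in \<open>R\<^sub>\<ge>\<^sub>n\<close>, so this generation statement can be transported to \<open>R'\<close> by \<open>\<phi>\<close>. It follows that \<open>J\<close>
  is generated by its elements of degree at most \<open>N + n\<close>, and these form a submodule of a finitely
  generated module over the noetherian ring \<open>R'\<^sub>0\<close>. The right-handed statement is the left-handed one
  for the opposite rings.

  For \<open>M\<close>, the left ideal \<open>R\<^sub>\<ge>\<^sub>n\<close> is finitely generated, so in high degrees \<open>M\<close> is generated by
  finitely many elements of degree at least \<open>n\<close>; transporting by \<open>\<phi>\<close> and \<open>\<psi>\<close> shows that \<open>M'\<close> is
  generated in bounded degree. Since \<open>\<phi>\<close> and \<open>\<psi>\<close> can be inverted, one implication suffices.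

  Every module that occurs is a subset of a ring, acted on by a subring through multiplication.
\<close>

section \<open>Spans and left submodules\<close>

definition additive_span :: "('a, 'm) ring_scheme \<Rightarrow> 'a set \<Rightarrow> 'a set" where
  "additive_span R P = generate (add_monoid R) P"

text \<open>Leaving the scalars \<open>C\<close> an arbitrary subset of the ambient ring lets one
  notion cover left ideals over the whole ring, components over the degree-zero part, and
  \<open>M\<close> over the image of \<open>R\<close>.\<close>

definition lspan :: "('a, 'm) ring_scheme \<Rightarrow> 'a set \<Rightarrow> 'a set \<Rightarrow> 'a set" where
  "lspan R C Y = additive_span R {c \<otimes>\<^bsub>R\<^esub> x | c x. c \<in> C \<and> x \<in> Y}"

definition left_submodule :: "('a, 'm) ring_scheme \<Rightarrow> 'a set \<Rightarrow> 'a set \<Rightarrow> bool" where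
  "left_submodule R C H \<longleftrightarrow> additive_subgroup H R \<and> (\<forall>c\<in>C. \<forall>h\<in>H. c \<otimes>\<^bsub>R\<^esub> h \<in> H)"

text \<open>Generators are asked to lie in the ring only: as soon as \<open>C\<close> contains the
  identity and lies in the ring, the equation with the span forces them into
  \<open>H\<close>.\<close>

definition finitely_spanned :: "('a, 'm) ring_scheme \<Rightarrow> 'a set \<Rightarrow> 'a set \<Rightarrow> bool" where
  "finitely_spanned R C H \<longleftrightarrow> (\<exists>S. finite S \<and> S \<subseteq> carrier R \<and> H = lspan R C S)"

text \<open>For a subring \<open>C\<close> these \<open>K\<close> are exactly its left ideals;
  phrasing this inside \<open>R\<close> avoids passing to a record for the subring.\<close>

definition left_noetherian_subring :: "('a, 'm) ring_scheme \<Rightarrow> 'a set \<Rightarrow> bool" where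
  "left_noetherian_subring R C \<longleftrightarrow>
    (\<forall>K. K \<subseteq> C \<and> left_submodule R C K \<longrightarrow> finitely_spanned R C K)"

context ring
begin

section \<open>Additive subgroups\<close>

lemma additive_subgroupI':
  assumes "H \<subseteq> carrier R" "\<zero> \<in> H"
    and "\<And>x y. \<lbrakk>x \<in> H; y \<in> H\<rbrakk> \<Longrightarrow> x \<oplus> y \<in> H" "\<And>x. x \<in> H \<Longrightarrow> \<ominus> x \<in> H"
  shows "additive_subgroup H R"
  by (rule additive_subgroup.intro, rule add.subgroupI) (use assms in \<open>auto simp: a_inv_def\<close>)

lemma additive_subgroup_carrier: "additive_subgroup (carrier R) R"
  by (rule additive_subgroupI') auto

lemma additive_subgroup_zero: "additive_subgroup {\<zero>} R"
  by (rule additive_subgroupI') auto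

lemma additive_subgroup_Int:
  assumes "additive_subgroup H R" "additive_subgroup K R"
  shows "additive_subgroup (H \<inter> K) R"
  using assms by (intro additive_subgroupI')
    (auto simp: additive_subgroup.a_Hcarr additive_subgroup.zero_closed additive_subgroup.a_closed
      additive_subgroup.a_inv_closed)

lemma additive_subgroup_minus:
  assumes "additive_subgroup H R" "x \<in> H" "y \<in> H"
  shows "x \<ominus> y \<in> H"
  using assms by (simp add: a_minus_def additive_subgroup.a_closed additive_subgroup.a_inv_closed)

lemma additive_subgroup_finsum:
  assumes "additive_subgroup H R" "f \<in> S \<rightarrow> H"
  shows "finsum R f S \<in> H"
  using assms(2)
proof (induction S rule: infinite_finite_induct)
  \<comment> \<open>A sum over an infinite index set has the default value zero, which lies in every
    subgroup.\<close>
  case (infinite S)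
  then show ?case
    using assms(1) by (simp add: finsum_infinite additive_subgroup.zero_closed)
next
  case empty
  then show ?case
    using assms(1) by (simp add: additive_subgroup.zero_closed)
next
  case (insert s S)
  have "f \<in> S \<rightarrow> carrier R" "f s \<in> carrier R"
    using insert.prems assms(1) by (auto simp: Pi_iff intro: additive_subgroup.a_Hcarr)
  then show ?case
    using insert assms(1) by (simp add: additive_subgroup.a_closed)
qed

text \<open>Left multiplication by \<open>c\<close> is additive. This allows a statement about all
  products with \<open>c\<close> to be checked on additive generators.\<close>

lemma additive_subgroup_vimage_mult:
  assumes "additive_subgroup H R" "additive_subgroup K R" "c \<in> carrier R"
  shows "additive_subgroup {x \<in> K. c \<otimes> x \<in> H} R"
  using assms by (intro additive_subgroupI')
    (auto simp: r_distr r_minus additive_subgroup.a_Hcarr additive_subgroup.zero_closed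
      additive_subgroup.a_closed additive_subgroup.a_inv_closed)

section \<open>Additive spans and spans over a set of scalars\<close>

lemma additive_span_subgroup: "P \<subseteq> carrier R \<Longrightarrow> additive_subgroup (additive_span R P) R"
  unfolding additive_span_def
  by (rule additive_subgroup.intro, rule add.generate_is_subgroup) simp

lemma additive_span_superset: "P \<subseteq> additive_span R P"
  unfolding additive_span_def by (auto intro: generate.incl)

lemma additive_span_least:
  "additive_subgroup H R \<Longrightarrow> P \<subseteq> H \<Longrightarrow> additive_span R P \<subseteq> H"
  unfolding additive_span_def
  by (rule add.generate_subgroup_incl) (auto dest: additive_subgroup.a_subgroup)

lemma products_subset: "C \<subseteq> carrier R \<Longrightarrow> Y \<subseteq> carrier R \<Longrightarrow>
    {c \<otimes> x | c x. c \<in> C \<and> x \<in> Y} \<subseteq> carrier R"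
  by auto

lemma lspan_subgroup:
  assumes "C \<subseteq> carrier R" "Y \<subseteq> carrier R"
  shows "additive_subgroup (lspan R C Y) R"
  unfolding lspan_def by (intro additive_span_subgroup products_subset assms)

lemma lspan_carrier:
  assumes "C \<subseteq> carrier R" "Y \<subseteq> carrier R"
  shows "lspan R C Y \<subseteq> carrier R"
  using lspan_subgroup[OF assms] by (rule additive_subgroup.a_subset)

lemma lspan_mult: "c \<in> C \<Longrightarrow> x \<in> Y \<Longrightarrow> c \<otimes> x \<in> lspan R C Y"
  unfolding lspan_def by (rule subsetD[OF additive_span_superset]) blast

lemma lspan_superset:
  assumes "\<one> \<in> C" "Y \<subseteq> carrier R"
  shows "Y \<subseteq> lspan R C Y"
proof
  fix x assume "x \<in> Y"
  then show "x \<in> lspan R C Y"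
    using lspan_mult[OF assms(1), of x Y] assms(2) by auto
qed

text \<open>Serves as an induction principle: \<open>H\<close> is typically the set of elements with
  some additive property, which is then checked on single products.\<close>

lemma lspan_subset:
  assumes "additive_subgroup H R" "\<And>c x. \<lbrakk>c \<in> C; x \<in> Y\<rbrakk> \<Longrightarrow> c \<otimes> x \<in> H"
  shows "lspan R C Y \<subseteq> H"
  unfolding lspan_def by (rule additive_span_least) (use assms in auto)

lemma lspan_least:
  assumes "left_submodule R C H" "Y \<subseteq> H"
  shows "lspan R C Y \<subseteq> H"
  using assms by (intro lspan_subset) (auto simp: left_submodule_def)

lemma lspan_empty: "C \<subseteq> carrier R \<Longrightarrow> lspan R C {} = {\<zero>}"
  using lspan_subset[OF additive_subgroup_zero, of C "{}"] lspan_subgroup[of C "{}"]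
  by (auto simp: additive_subgroup.zero_closed)

text \<open>For fixed \<open>c\<close>, the elements that \<open>c\<close> multiplies into the span
  form an additive subgroup. By associativity and closure of \<open>C\<close> under products, it
  contains the generators.\<close>

lemma lspan_submodule:
  assumes "subring C R" "Y \<subseteq> carrier R"
  shows "left_submodule R C (lspan R C Y)"
  unfolding left_submodule_def
proof (intro conjI ballI)
  have C: "C \<subseteq> carrier R"
    using subringE(1)[OF assms(1)] .
  show sub: "additive_subgroup (lspan R C Y) R"
    using C assms(2) by (rule lspan_subgroup)
  fix c v assume c: "c \<in> C" and v: "v \<in> lspan R C Y"
  have "lspan R C Y \<subseteq> {x \<in> carrier R. c \<otimes> x \<in> lspan R C Y}"
  proof (rule lspan_subset)
    show "additive_subgroup {x \<in> carrier R. c \<otimes> x \<in> lspan R C Y} R"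
      using c C by (intro additive_subgroup_vimage_mult sub additive_subgroup_carrier) auto
    fix d x assume d: "d \<in> C" and x: "x \<in> Y"
    have "c \<otimes> (d \<otimes> x) = (c \<otimes> d) \<otimes> x"
      using c d x C assms(2) by (simp add: m_assoc subset_iff)
    moreover have "c \<otimes> d \<in> C"
      using c d subringE(6)[OF assms(1)] by auto
    ultimately show "d \<otimes> x \<in> {x \<in> carrier R. c \<otimes> x \<in> lspan R C Y}"
      using d x C assms(2) by (auto simp: subset_iff intro: lspan_mult)
  qed
  then show "c \<otimes> v \<in> lspan R C Y"
    using v by auto
qed

lemma lspan_mono:
  assumes "C \<subseteq> carrier R" "C \<subseteq> D" "D \<subseteq> carrier R" "Y \<subseteq> Z" "Z \<subseteq> carrier R"
  shows "lspan R C Y \<subseteq> lspan R D Z"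
  using assms by (intro lspan_subset lspan_subgroup lspan_mult) auto

text \<open>Elements that need only finitely many generators form an additive subgroup, since the
  union of two finite sets of generators is finite.\<close>

lemma lspan_finite_support:
  assumes C: "C \<subseteq> carrier R" and Y: "Y \<subseteq> carrier R" and v: "v \<in> lspan R C Y"
  obtains F where "finite F" "F \<subseteq> Y" "v \<in> lspan R C F"
proof -
  let ?H = "{v. \<exists>F. finite F \<and> F \<subseteq> Y \<and> v \<in> lspan R C F}"
  have sub: "additive_subgroup (lspan R C F) R" if "F \<subseteq> Y" for F
    using C Y that by (intro lspan_subgroup) auto
  have "lspan R C Y \<subseteq> ?H"
  proof (rule lspan_subset)
    show "additive_subgroup ?H R"
    proof (rule additive_subgroupI')
      show "?H \<subseteq> carrier R"
        using sub additive_subgroup.a_subset by blast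
      show "\<zero> \<in> ?H"
        using sub[of "{}"] additive_subgroup.zero_closed by blast
    next
      fix x y assume "x \<in> ?H" "y \<in> ?H"
      then obtain F G where F: "finite F" "F \<subseteq> Y" "x \<in> lspan R C F"
        and G: "finite G" "G \<subseteq> Y" "y \<in> lspan R C G"
        by blast
      have "x \<in> lspan R C (F \<union> G)" "y \<in> lspan R C (F \<union> G)"
        using F G C Y lspan_mono[of C C F "F \<union> G"] lspan_mono[of C C G "F \<union> G"]
        by (auto simp: subset_iff)
      then show "x \<oplus> y \<in> ?H"
        using F G sub[of "F \<union> G"] additive_subgroup.a_closed[of _ R x y]
        by (intro CollectI exI[of _ "F \<union> G"]) auto
    next
      fix x assume "x \<in> ?H"
      then obtain F where "finite F" "F \<subseteq> Y" "x \<in> lspan R C F"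
        by blast
      then show "\<ominus> x \<in> ?H"
        using additive_subgroup.a_inv_closed[OF sub[of F]] by blast
    qed
    fix c x assume "c \<in> C" "x \<in> Y"
    then show "c \<otimes> x \<in> ?H"
      by (intro CollectI exI[of _ "{x}"]) (auto intro: lspan_mult)
  qed
  with v that show ?thesis
    by blast
qed

text \<open>Each of the given finitely many generators involves only finitely many elements of
  \<open>Y\<close>, and collecting these suffices. It is applied with homogeneous \<open>Y\<close>,
  so that the generators obtained have degrees.\<close>

lemma finitely_spanned_by_subset:
  assumes C: "subring C R" and Y: "Y \<subseteq> carrier R" and fin: "finitely_spanned R C (lspan R C Y)"
  obtains F where "finite F" "F \<subseteq> Y" "lspan R C Y = lspan R C F"
proof -
  have CR: "C \<subseteq> carrier R" and one: "\<one> \<in> C"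
    using C subringE(1,3) by auto
  obtain S where S: "finite S" "S \<subseteq> carrier R" "lspan R C Y = lspan R C S"
    using fin by (auto simp: finitely_spanned_def)
  have "\<forall>s\<in>S. \<exists>F. finite F \<and> F \<subseteq> Y \<and> s \<in> lspan R C F"
    using lspan_superset[OF one S(2)] S(3) lspan_finite_support[OF CR Y] by (metis subsetD)
  then obtain F where F: "\<And>s. s \<in> S \<Longrightarrow> finite (F s) \<and> F s \<subseteq> Y \<and> s \<in> lspan R C (F s)"
    by metis
  let ?F = "\<Union>s\<in>S. F s"
  have FX: "?F \<subseteq> Y"
    using F by auto
  have "S \<subseteq> lspan R C ?F"
  proof
    fix s assume s: "s \<in> S"
    then have "lspan R C (F s) \<subseteq> lspan R C ?F"
      using FX Y CR by (intro lspan_mono) auto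
    then show "s \<in> lspan R C ?F"
      using F[OF s] by auto
  qed
  then have "lspan R C S \<subseteq> lspan R C ?F"
    using FX Y by (intro lspan_least lspan_submodule C) auto
  moreover have "lspan R C ?F \<subseteq> lspan R C Y"
    using FX Y CR by (intro lspan_mono) auto
  ultimately show ?thesis
    using that[of ?F] S F FX by auto
qed

text \<open>Submodules of finitely generated modules over a left noetherian ring are finitely
  generated. When a generator \<open>v\<close> is added, the coefficients of \<open>v\<close>
  occurring in \<open>W\<close> form a left ideal of \<open>C\<close>; lifts of its generators to
  \<open>W\<close>, together with generators of the part of \<open>W\<close> that lies in the old
  span, generate \<open>W\<close>.\<close>

lemma finitely_spanned_submodule:
  assumes C: "subring C R" and noeth: "left_noetherian_subring R C"
    and "finite S" "S \<subseteq> carrier R" "left_submodule R C W" "W \<subseteq> lspan R C S"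
  shows "finitely_spanned R C W"
  using assms(3-)
proof (induction S arbitrary: W rule: finite_induct)
  case empty
  have CR: "C \<subseteq> carrier R"
    using subringE(1)[OF C] .
  have "W = {\<zero>}"
    using empty lspan_empty[OF CR]
    by (auto simp: left_submodule_def dest: additive_subgroup.zero_closed)
  then show ?case
    unfolding finitely_spanned_def using lspan_empty[OF CR] by (intro exI[of _ "{}"]) auto
next
  case (insert v S)
  have CR: "C \<subseteq> carrier R" and one: "\<one> \<in> C"
    using C subringE(1,3) by auto
  have v: "v \<in> carrier R" and SR: "S \<subseteq> carrier R"
    using insert.prems by auto
  have Cadd: "additive_subgroup C R"
    using subring.axioms(1)[OF C] by (rule additive_subgroup.intro)
  let ?V = "lspan R C S"
  have V: "left_submodule R C ?V" and Vadd: "additive_subgroup ?V R"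
    using lspan_submodule[OF C SR] by (auto simp: left_submodule_def)
  have Wadd: "additive_subgroup W R" and Wmult: "\<And>c w. c \<in> C \<Longrightarrow> w \<in> W \<Longrightarrow> c \<otimes> w \<in> W"
    using insert.prems by (auto simp: left_submodule_def)
  note closed = additive_subgroup.a_closed additive_subgroup.a_inv_closed
    additive_subgroup.zero_closed additive_subgroup.a_Hcarr
  \<comment> \<open>\<open>H\<close> is kept arbitrary because the same set of coefficients is
    formed for \<open>W\<close> and later for the span of the chosen generators.\<close>
  have ext: "additive_subgroup {c \<in> C. \<exists>u\<in>?V. c \<otimes> v \<oplus> u \<in> H} R" if H: "additive_subgroup H R" for H
  proof (rule additive_subgroupI')
    show "{c \<in> C. \<exists>u\<in>?V. c \<otimes> v \<oplus> u \<in> H} \<subseteq> carrier R"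
      using CR by auto
    show "\<zero> \<in> {c \<in> C. \<exists>u\<in>?V. c \<otimes> v \<oplus> u \<in> H}"
      using v closed(3)[OF Vadd] closed(3)[OF H] closed(3)[OF Cadd]
      by (auto intro!: bexI[of _ \<zero>])
  next
    fix x y assume "x \<in> {c \<in> C. \<exists>u\<in>?V. c \<otimes> v \<oplus> u \<in> H}" "y \<in> {c \<in> C. \<exists>u\<in>?V. c \<otimes> v \<oplus> u \<in> H}"
    then obtain u u' where x: "x \<in> C" "u \<in> ?V" "x \<otimes> v \<oplus> u \<in> H"
      and y: "y \<in> C" "u' \<in> ?V" "y \<otimes> v \<oplus> u' \<in> H"
      by auto
    have c: "x \<in> carrier R" "y \<in> carrier R" "u \<in> carrier R" "u' \<in> carrier R"
      using x y CR closed(4)[OF Vadd] by auto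
    have "(x \<oplus> y) \<otimes> v \<oplus> (u \<oplus> u') = (x \<otimes> v \<oplus> u) \<oplus> (y \<otimes> v \<oplus> u')"
      using c v by algebra
    also have "\<dots> \<in> H"
      using x y closed(1)[OF H] by simp
    finally show "x \<oplus> y \<in> {c \<in> C. \<exists>u\<in>?V. c \<otimes> v \<oplus> u \<in> H}"
      using x y closed(1)[OF Vadd] closed(1)[OF Cadd] by auto
  next
    fix x assume "x \<in> {c \<in> C. \<exists>u\<in>?V. c \<otimes> v \<oplus> u \<in> H}"
    then obtain u where x: "x \<in> C" "u \<in> ?V" "x \<otimes> v \<oplus> u \<in> H"
      by auto
    have c: "x \<in> carrier R" "u \<in> carrier R"
      using x CR closed(4)[OF Vadd] by auto
    have "(\<ominus> x) \<otimes> v \<oplus> (\<ominus> u) = \<ominus> (x \<otimes> v \<oplus> u)"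
      using c v by algebra
    also have "\<dots> \<in> H"
      using x closed(2)[OF H] by simp
    finally show "\<ominus> x \<in> {c \<in> C. \<exists>u\<in>?V. c \<otimes> v \<oplus> u \<in> H}"
      using x closed(2)[OF Vadd] closed(2)[OF Cadd] by auto
  qed
  let ?K = "{c \<in> C. \<exists>u\<in>?V. c \<otimes> v \<oplus> u \<in> W}"
  have K: "left_submodule R C ?K"
    unfolding left_submodule_def
  proof (intro conjI ballI)
    show "additive_subgroup ?K R"
      using ext[OF Wadd] .
    fix c k assume c: "c \<in> C" and "k \<in> ?K"
    then obtain u where k: "k \<in> C" "u \<in> ?V" "k \<otimes> v \<oplus> u \<in> W"
      by auto
    have "(c \<otimes> k) \<otimes> v \<oplus> c \<otimes> u = c \<otimes> (k \<otimes> v \<oplus> u)"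
      using c k v CR closed(4)[OF Vadd] by (simp add: subset_iff r_distr m_assoc)
    also have "\<dots> \<in> W"
      using c k Wmult by simp
    finally show "c \<otimes> k \<in> ?K"
      using c k V subringE(6)[OF C] by (auto simp: left_submodule_def)
  qed
  then have "finitely_spanned R C ?K"
    using noeth by (auto simp: left_noetherian_subring_def)
  then obtain G where G: "finite G" "G \<subseteq> carrier R" "?K = lspan R C G"
    by (auto simp: finitely_spanned_def)
  have "\<forall>g\<in>G. \<exists>u\<in>?V. g \<otimes> v \<oplus> u \<in> W"
    using lspan_superset[OF one G(2)] G(3) by blast
  then obtain u where u: "\<And>g. g \<in> G \<Longrightarrow> u g \<in> ?V \<and> g \<otimes> v \<oplus> u g \<in> W"
    by metis
  \<comment> \<open>Each generator \<open>g\<close> of the coefficient ideal is lifted to an element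
    of \<open>W\<close> in which \<open>v\<close> has coefficient \<open>g\<close>.\<close>
  let ?w = "\<lambda>g. g \<otimes> v \<oplus> u g"
  have "left_submodule R C (W \<inter> ?V)"
    using insert.prems V additive_subgroup_Int by (auto simp: left_submodule_def)
  then have "finitely_spanned R C (W \<inter> ?V)"
    using insert.IH SR by auto
  then obtain T where T: "finite T" "T \<subseteq> carrier R" "W \<inter> ?V = lspan R C T"
    by (auto simp: finitely_spanned_def)
  let ?T = "?w ` G \<union> T"
  have TW: "?T \<subseteq> W"
    using u T lspan_superset[OF one T(2)] by auto
  have WR: "W \<subseteq> carrier R"
    using Wadd by (rule additive_subgroup.a_subset)
  have spanT: "left_submodule R C (lspan R C ?T)" and spanTadd: "additive_subgroup (lspan R C ?T) R"
    using lspan_submodule[OF C, of ?T] TW WR by (auto simp: left_submodule_def)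
  have spanTW: "lspan R C ?T \<subseteq> W"
    using TW insert.prems by (intro lspan_least) auto
  \<comment> \<open>Every coefficient that occurs in \<open>W\<close> already occurs in the span of
    the lifts; by additivity only multiples of the generators \<open>G\<close> need to be
    checked.\<close>
  have KT: "?K \<subseteq> {c \<in> C. \<exists>u\<in>?V. c \<otimes> v \<oplus> u \<in> lspan R C ?T}"
    unfolding G(3)
  proof (rule lspan_subset)
    show "additive_subgroup {c \<in> C. \<exists>u\<in>?V. c \<otimes> v \<oplus> u \<in> lspan R C ?T} R"
      using ext[OF spanTadd] .
    fix c g assume c: "c \<in> C" and g: "g \<in> G"
    have gC: "g \<in> C"
      using lspan_superset[OF one G(2)] G(3) g by blast
    have "(c \<otimes> g) \<otimes> v \<oplus> c \<otimes> u g = c \<otimes> ?w g"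
      using c g gC v CR u[OF g] closed(4)[OF Vadd] by (simp add: subset_iff r_distr m_assoc)
    also have "\<dots> \<in> lspan R C ?T"
      using c g by (intro lspan_mult) auto
    finally show "c \<otimes> g \<in> {c \<in> C. \<exists>u\<in>?V. c \<otimes> v \<oplus> u \<in> lspan R C ?T}"
      using c gC u[OF g] V subringE(6)[OF C] by (auto simp: left_submodule_def)
  qed
  have "W \<subseteq> lspan R C ?T"
  proof
    fix w assume w: "w \<in> W"
    \<comment> \<open>Splits off a multiple of \<open>v\<close>: the right-hand set is additive, and
      it contains multiples of \<open>v\<close> with their own coefficient and multiples of elements
      of \<open>S\<close> with coefficient zero.\<close>
    have "lspan R C (insert v S) \<subseteq> {w \<in> carrier R. \<exists>c\<in>C. w \<ominus> c \<otimes> v \<in> ?V}"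
    proof (rule lspan_subset)
      show "additive_subgroup {w \<in> carrier R. \<exists>c\<in>C. w \<ominus> c \<otimes> v \<in> ?V} R"
      proof (rule additive_subgroupI')
        show "\<zero> \<in> {w \<in> carrier R. \<exists>c\<in>C. w \<ominus> c \<otimes> v \<in> ?V}"
          using v closed(3)[OF Vadd] closed(3)[OF Cadd]
          by (auto intro!: bexI[of _ \<zero>] simp: a_minus_def)
      next
        fix x y assume "x \<in> {w \<in> carrier R. \<exists>c\<in>C. w \<ominus> c \<otimes> v \<in> ?V}"
          "y \<in> {w \<in> carrier R. \<exists>c\<in>C. w \<ominus> c \<otimes> v \<in> ?V}"
        then obtain c d where x: "x \<in> carrier R" "c \<in> C" "x \<ominus> c \<otimes> v \<in> ?V"
          and y: "y \<in> carrier R" "d \<in> C" "y \<ominus> d \<otimes> v \<in> ?V"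
          by auto
        have cd: "c \<in> carrier R" "d \<in> carrier R"
          using x y CR by auto
        have "(x \<oplus> y) \<ominus> (c \<oplus> d) \<otimes> v = (x \<ominus> c \<otimes> v) \<oplus> (y \<ominus> d \<otimes> v)"
          using x(1) y(1) cd v by algebra
        also have "\<dots> \<in> ?V"
          using x y closed(1)[OF Vadd] by simp
        finally show "x \<oplus> y \<in> {w \<in> carrier R. \<exists>c\<in>C. w \<ominus> c \<otimes> v \<in> ?V}"
          using x y closed(1)[OF Cadd] by auto
      next
        fix x assume "x \<in> {w \<in> carrier R. \<exists>c\<in>C. w \<ominus> c \<otimes> v \<in> ?V}"
        then obtain c where x: "x \<in> carrier R" "c \<in> C" "x \<ominus> c \<otimes> v \<in> ?V"
          by auto
        have c: "c \<in> carrier R"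
          using x CR by auto
        have "(\<ominus> x) \<ominus> (\<ominus> c) \<otimes> v = \<ominus> (x \<ominus> c \<otimes> v)"
          using x(1) c v by algebra
        also have "\<dots> \<in> ?V"
          using x closed(2)[OF Vadd] by simp
        finally show "\<ominus> x \<in> {w \<in> carrier R. \<exists>c\<in>C. w \<ominus> c \<otimes> v \<in> ?V}"
          using x closed(2)[OF Cadd] by auto
      qed auto
      fix c x assume c: "c \<in> C" and x: "x \<in> insert v S"
      show "c \<otimes> x \<in> {w \<in> carrier R. \<exists>c\<in>C. w \<ominus> c \<otimes> v \<in> ?V}"
      proof (cases "x = v")
        case True
        have "c \<otimes> v \<ominus> c \<otimes> v = \<zero>"
          using c v CR by (auto simp: subset_iff a_minus_def r_neg)
        then show ?thesis
          using c v CR closed(3)[OF Vadd] True by (auto intro!: bexI[of _ c])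
      next
        case False
        then have "x \<in> S"
          using x by simp
        then have "c \<otimes> x \<ominus> \<zero> \<otimes> v \<in> ?V" "c \<otimes> x \<in> carrier R"
          using c v CR SR lspan_mult[of c C x S] by (auto simp: subset_iff a_minus_def)
        then show ?thesis
          using closed(3)[OF Cadd] by auto
      qed
    qed
    then obtain c where c: "c \<in> C" "w \<ominus> c \<otimes> v \<in> ?V"
      using w insert.prems by auto
    have cR: "c \<in> carrier R" "w \<in> carrier R"
      using c w CR WR by auto
    have "c \<otimes> v \<oplus> (w \<ominus> c \<otimes> v) = w"
      using cR v by algebra
    then have "c \<in> ?K"
      using c w by (auto intro!: bexI[of _ "w \<ominus> c \<otimes> v"])
    then obtain u' where u': "u' \<in> ?V" "c \<otimes> v \<oplus> u' \<in> lspan R C ?T"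
      using KT by auto
    have u'R: "u' \<in> carrier R"
      using u' closed(4)[OF Vadd] by simp
    \<comment> \<open>Subtracting the element of the span with the same coefficient of
      \<open>v\<close> leaves an element of \<open>W \<inter> ?V\<close>, which \<open>T\<close>
      generates.\<close>
    have "w \<ominus> (c \<otimes> v \<oplus> u') = (w \<ominus> c \<otimes> v) \<ominus> u'"
      using cR v u'R by algebra
    then have "w \<ominus> (c \<otimes> v \<oplus> u') \<in> W \<inter> ?V"
      using additive_subgroup_minus[OF Vadd c(2) u'(1)]
        additive_subgroup_minus[OF Wadd w, of "c \<otimes> v \<oplus> u'"] u'(2) spanTW by auto
    then have "w \<ominus> (c \<otimes> v \<oplus> u') \<in> lspan R C T"
      using T by simp
    also have "\<dots> \<subseteq> lspan R C ?T"
      using TW WR CR by (intro lspan_mono) auto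
    finally have "(w \<ominus> (c \<otimes> v \<oplus> u')) \<oplus> (c \<otimes> v \<oplus> u') \<in> lspan R C ?T"
      using u'(2) closed(1)[OF spanTadd] by simp
    moreover have "(w \<ominus> (c \<otimes> v \<oplus> u')) \<oplus> (c \<otimes> v \<oplus> u') = w"
      using cR v u'R by algebra
    ultimately show "w \<in> lspan R C ?T"
      by simp
  qed
  then show ?case
    unfolding finitely_spanned_def using spanTW TW WR G(1) T(1)
    by (intro exI[of _ ?T]) auto
qed

end

section \<open>Graded rings\<close>

text \<open>The description selects the whole family of components, which is then evaluated at
  \<open>i\<close>. The value is unspecified for \<open>x\<close> outside the carrier.\<close>

definition hcomp :: "('a, 'm) ring_scheme \<Rightarrow> (nat \<Rightarrow> 'a set) \<Rightarrow> nat \<Rightarrow> 'a \<Rightarrow> 'a" where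
  "hcomp R A i x = (THE f. (\<forall>i. f i \<in> A i) \<and> finite {i. f i \<noteq> \<zero>\<^bsub>R\<^esub>} \<and>
     x = (\<Oplus>\<^bsub>R\<^esub>i\<in>{i. f i \<noteq> \<zero>\<^bsub>R\<^esub>}. f i)) i"

context graded_ring
begin

section \<open>Homogeneous components\<close>

abbreviation hc where "hc \<equiv> hcomp R A"

lemma hcomp_props:
  assumes "x \<in> carrier R"
  shows hcomp_mem: "hc i x \<in> A i"
    and finite_hcomp_support: "finite {i. hc i x \<noteq> \<zero>}"
    and hcomp_sum: "x = (\<Oplus>i\<in>{i. hc i x \<noteq> \<zero>}. hc i x)"
proof -
  let ?P = "\<lambda>f. (\<forall>i. f i \<in> A i) \<and> finite {i. f i \<noteq> \<zero>} \<and> x = (\<Oplus>i\<in>{i. f i \<noteq> \<zero>}. f i)"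
  have "(\<lambda>i. hc i x) = (THE f. ?P f)"
    by (auto simp: hcomp_def)
  then have P: "?P (\<lambda>i. hc i x)"
    using theI'[OF decomposition[OF assms]] by metis
  then show "hc i x \<in> A i" "finite {i. hc i x \<noteq> \<zero>}" "x = (\<Oplus>i\<in>{i. hc i x \<noteq> \<zero>}. hc i x)"
    by blast+
qed

lemma component_carrier: "x \<in> A i \<Longrightarrow> x \<in> carrier R"
  using additive_subgroup.a_Hcarr[OF component_subgroup] .

lemma component_subset: "A i \<subseteq> carrier R"
  using component_carrier by auto

lemma component_zero: "\<zero> \<in> A i"
  using additive_subgroup.zero_closed[OF component_subgroup] .

lemma component_add: "x \<in> A i \<Longrightarrow> y \<in> A i \<Longrightarrow> x \<oplus> y \<in> A i"
  using additive_subgroup.a_closed[OF component_subgroup] .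

lemma component_a_inv: "x \<in> A i \<Longrightarrow> \<ominus> x \<in> A i"
  using additive_subgroup.a_inv_closed[OF component_subgroup] .

lemma hcomp_carrier [simp]: "x \<in> carrier R \<Longrightarrow> hc i x \<in> carrier R"
  using hcomp_mem component_carrier by blast

text \<open>\<open>F\<close> may be larger than the support of \<open>f\<close>, so that two
  elements can be compared over the union of their supports.\<close>

lemma hcomp_unique:
  assumes f: "\<And>i. f i \<in> A i" and F: "finite F" "\<And>i. i \<notin> F \<Longrightarrow> f i = \<zero>"
  shows "hc i (\<Oplus>i\<in>F. f i) = f i"
proof -
  let ?x = "\<Oplus>i\<in>F. f i"
  have fc: "f \<in> I \<rightarrow> carrier R" for I
    using f component_carrier by auto
  have "?x = (\<Oplus>i\<in>{i. f i \<noteq> \<zero>}. f i)"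
    using F fc[of F] by (intro add.finprod_mono_neutral_cong_right) (auto simp: Pi_iff)
  moreover have "finite {i. f i \<noteq> \<zero>}"
    using F(1) by (rule rev_finite_subset) (use F(2) in auto)
  ultimately have "(THE f. (\<forall>i. f i \<in> A i) \<and> finite {i. f i \<noteq> \<zero>} \<and>
     ?x = (\<Oplus>i\<in>{i. f i \<noteq> \<zero>}. f i)) = f"
    using f fc[of "{i. f i \<noteq> \<zero>}"] by (intro the1_equality decomposition) auto
  then show ?thesis
    by (simp add: hcomp_def)
qed

lemma hcomp_homogeneous:
  assumes "x \<in> A j"
  shows "hc i x = (if i = j then x else \<zero>)"
proof -
  have "(\<Oplus>i\<in>{j}. if i = j then x else \<zero>) = x"
    using component_carrier[OF assms] by simp
  then show ?thesis
    using hcomp_unique[of "\<lambda>i. if i = j then x else \<zero>" "{j}" i] assms component_zero by auto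
qed

lemma hcomp_zero [simp]: "hc i \<zero> = \<zero>"
  using hcomp_homogeneous[OF component_zero[of i], of i] by simp

lemma sum_hcomp:
  assumes "x \<in> carrier R" "finite F" "{i. hc i x \<noteq> \<zero>} \<subseteq> F"
  shows "x = (\<Oplus>i\<in>F. hc i x)"
proof -
  have "(\<Oplus>i\<in>F. hc i x) = (\<Oplus>i\<in>{i. hc i x \<noteq> \<zero>}. hc i x)"
    using assms by (intro add.finprod_mono_neutral_cong_right) auto
  then show ?thesis
    using hcomp_sum[OF assms(1)] by simp
qed

lemma hcomp_add:
  assumes x: "x \<in> carrier R" and y: "y \<in> carrier R"
  shows "hc i (x \<oplus> y) = hc i x \<oplus> hc i y"
proof -
  let ?F = "{i. hc i x \<noteq> \<zero>} \<union> {i. hc i y \<noteq> \<zero>}"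
  have fin: "finite ?F"
    using x y finite_hcomp_support by auto
  have "(\<Oplus>i\<in>?F. hc i x \<oplus> hc i y) = (\<Oplus>i\<in>?F. hc i x) \<oplus> (\<Oplus>i\<in>?F. hc i y)"
    using x y by (intro finsum_addf) auto
  also have "\<dots> = x \<oplus> y"
    using x y fin sum_hcomp[of x ?F] sum_hcomp[of y ?F] by auto
  finally have "x \<oplus> y = (\<Oplus>i\<in>?F. hc i x \<oplus> hc i y)" ..
  then show ?thesis
    using hcomp_unique[of "\<lambda>i. hc i x \<oplus> hc i y" ?F i] x y fin
    by (auto intro: component_add hcomp_mem)
qed

lemma hcomp_a_inv:
  assumes x: "x \<in> carrier R"
  shows "hc i (\<ominus> x) = \<ominus> hc i x"
proof -
  have "hc i (\<ominus> x) \<oplus> hc i x = \<zero>"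
    using x hcomp_add[of "\<ominus> x" x i] by (simp add: l_neg)
  then show ?thesis
    using x by (simp add: minus_equality)
qed

lemma hcomp_minus:
  "x \<in> carrier R \<Longrightarrow> y \<in> carrier R \<Longrightarrow> hc i (x \<ominus> y) = hc i x \<ominus> hc i y"
  by (simp add: a_minus_def hcomp_add hcomp_a_inv)

lemma mem_if_hcomp_mem:
  assumes "additive_subgroup H R" "x \<in> carrier R" "\<And>i. hc i x \<in> H"
  shows "x \<in> H"
  using additive_subgroup_finsum[OF assms(1), of "\<lambda>i. hc i x" "{i. hc i x \<noteq> \<zero>}"]
    hcomp_sum[OF assms(2)] assms(3) by simp

text \<open>The linearity principle for graded rings: a property that defines an additive subgroup
  holds everywhere once it holds for homogeneous elements.\<close>

lemma carrier_subset_if_homogeneous: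
  assumes "additive_subgroup H R" "\<And>i. A i \<subseteq> H"
  shows "carrier R \<subseteq> H"
  using mem_if_hcomp_mem[OF assms(1)] hcomp_mem assms(2) by blast

text \<open>Tails, bounds on the degree from above and conditions on a single component are all
  instances.\<close>

lemma additive_subgroup_vimage_hcomp:
  assumes "\<And>i. i \<in> I \<Longrightarrow> additive_subgroup (W i) R"
  shows "additive_subgroup {x \<in> carrier R. \<forall>i\<in>I. hc i x \<in> W i} R"
  using assms by (intro additive_subgroupI')
    (auto simp: hcomp_add hcomp_a_inv additive_subgroup.zero_closed
      additive_subgroup.a_closed additive_subgroup.a_inv_closed)

text \<open>Both sides are additive in \<open>r\<close>, so homogeneous \<open>r\<close> suffice.
  The case distinction is needed because \<open>d - i\<close> is truncated to 0 when
  \<open>i\<close> exceeds \<open>d\<close>.\<close>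

lemma hcomp_mult_right:
  assumes f: "f \<in> A i" and r: "r \<in> carrier R"
  shows "hc d (r \<otimes> f) = (if i \<le> d then hc (d - i) r \<otimes> f else \<zero>)"
proof -
  let ?H = "{r \<in> carrier R. \<forall>d. hc d (r \<otimes> f) = (if i \<le> d then hc (d - i) r \<otimes> f else \<zero>)}"
  have fc: "f \<in> carrier R"
    using f component_carrier by blast
  have "carrier R \<subseteq> ?H"
  proof (rule carrier_subset_if_homogeneous)
    show "additive_subgroup ?H R"
      using fc by (intro additive_subgroupI')
        (auto simp: hcomp_add hcomp_a_inv l_distr l_minus)
    show "A j \<subseteq> ?H" for j
    proof
      fix r assume r: "r \<in> A j"
      have "r \<otimes> f \<in> A (j + i)"
        using r f by (rule component_mult)
      then show "r \<in> ?H"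
        using fc component_carrier[OF r] by (auto simp: hcomp_homogeneous hcomp_homogeneous[OF r])
    qed
  qed
  then show ?thesis
    using r by auto
qed

lemma hcomp_mult_left:
  assumes f: "f \<in> A i" and r: "r \<in> carrier R"
  shows "hc d (f \<otimes> r) = (if i \<le> d then f \<otimes> hc (d - i) r else \<zero>)"
proof -
  let ?H = "{r \<in> carrier R. \<forall>d. hc d (f \<otimes> r) = (if i \<le> d then f \<otimes> hc (d - i) r else \<zero>)}"
  have fc: "f \<in> carrier R"
    using f component_carrier by blast
  have "carrier R \<subseteq> ?H"
  proof (rule carrier_subset_if_homogeneous)
    show "additive_subgroup ?H R"
      using fc by (intro additive_subgroupI')
        (auto simp: hcomp_add hcomp_a_inv r_distr r_minus)
    show "A j \<subseteq> ?H" for j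
    proof
      fix r assume r: "r \<in> A j"
      have "f \<otimes> r \<in> A (i + j)"
        using f r by (rule component_mult)
      then show "r \<in> ?H"
        using fc component_carrier[OF r] by (auto simp: hcomp_homogeneous hcomp_homogeneous[OF r])
    qed
  qed
  then show ?thesis
    using r by auto
qed

text \<open>
  The degree-zero part of \<open>\<one>\<close> is a right identity for every homogeneous element, hence for
  \<open>\<one>\<close> itself.
\<close>

lemma one_in_component_zero: "\<one> \<in> A 0"
proof -
  let ?e = "hc 0 \<one>"
  have "carrier R \<subseteq> {x \<in> carrier R. x \<otimes> ?e = x}"
  proof (rule carrier_subset_if_homogeneous)
    show "additive_subgroup {x \<in> carrier R. x \<otimes> ?e = x} R"
      by (intro additive_subgroupI') (auto simp: l_distr l_minus)
    show "A j \<subseteq> {x \<in> carrier R. x \<otimes> ?e = x}" for j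
    proof
      fix x assume x: "x \<in> A j"
      have "x \<otimes> ?e = hc j (x \<otimes> \<one>)"
        using hcomp_mult_left[OF x one_closed, of j] by simp
      then show "x \<in> {x \<in> carrier R. x \<otimes> ?e = x}"
        using component_carrier[OF x] hcomp_homogeneous[OF x, of j] by simp
    qed
  qed
  then have "\<one> \<otimes> ?e = \<one>"
    by blast
  then have "?e = \<one>"
    by simp
  then show ?thesis
    using hcomp_mem[OF one_closed, of 0] by simp
qed

lemma subring_component_zero: "subring (A 0) R"
proof (rule subringI)
  fix x y assume "x \<in> A 0" "y \<in> A 0"
  then show "x \<otimes> y \<in> A 0"
    using component_mult[of x 0 y 0] by simp
qed (use component_subset one_in_component_zero component_add component_a_inv in auto)

text \<open>The vanishing of low components is preserved by sums and holds for each summand;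
  conversely, the decomposition into components is itself a sum of the required form. Membership in
  a tail thus becomes a condition on each degree.\<close>

lemma tail_eq: "tail R A n = {x \<in> carrier R. \<forall>i<n. hc i x = \<zero>}"
proof (intro equalityI subsetI)
  fix x assume "x \<in> tail R A n"
  then obtain F f where F: "finite F" "F \<subseteq> {n..}" "\<forall>i\<in>F. f i \<in> A i" "x = (\<Oplus>i\<in>F. f i)"
    by (auto simp: tail_def)
  have "additive_subgroup {x \<in> carrier R. \<forall>i\<in>{..<n}. hc i x \<in> {\<zero>}} R"
    using additive_subgroup_zero by (rule additive_subgroup_vimage_hcomp)
  moreover have "f \<in> F \<rightarrow> {x \<in> carrier R. \<forall>i\<in>{..<n}. hc i x \<in> {\<zero>}}"
  proof
    fix i assume i: "i \<in> F"
    then have "f i \<in> A i" "i \<ge> n"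
      using F by auto
    then show "f i \<in> {x \<in> carrier R. \<forall>i\<in>{..<n}. hc i x \<in> {\<zero>}}"
      by (auto simp: hcomp_homogeneous intro: component_carrier)
  qed
  ultimately have "x \<in> {x \<in> carrier R. \<forall>i\<in>{..<n}. hc i x \<in> {\<zero>}}"
    unfolding F(4) by (rule additive_subgroup_finsum)
  then show "x \<in> {x \<in> carrier R. \<forall>i<n. hc i x = \<zero>}"
    by auto
next
  fix x assume x: "x \<in> {x \<in> carrier R. \<forall>i<n. hc i x = \<zero>}"
  then have "\<forall>i. hc i x \<noteq> \<zero> \<longrightarrow> n \<le> i"
    by (auto simp: not_less[symmetric])
  then show "x \<in> tail R A n"
    unfolding tail_def using x hcomp_sum[of x] finite_hcomp_support[of x] hcomp_mem[of x]
    by (intro CollectI exI[of _ "{i. hc i x \<noteq> \<zero>}"] exI[of _ "\<lambda>i. hc i x"]) auto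
qed

lemma tail_subgroup: "additive_subgroup (tail R A n) R"
  using additive_subgroup_vimage_hcomp[of "{..<n}" "\<lambda>_. {\<zero>}"] additive_subgroup_zero
  by (simp add: tail_eq Ball_def)

lemma component_subset_tail: "n \<le> i \<Longrightarrow> A i \<subseteq> tail R A n"
  by (auto simp: tail_eq hcomp_homogeneous component_carrier)

lemma tail_subset_if_homogeneous:
  assumes "additive_subgroup H R" "\<And>i. n \<le> i \<Longrightarrow> A i \<subseteq> H"
  shows "tail R A n \<subseteq> H"
proof
  fix x assume x: "x \<in> tail R A n"
  have "hc i x \<in> H" for i
  proof (cases "i < n")
    case True
    then show ?thesis
      using x assms(1) by (simp add: tail_eq additive_subgroup.zero_closed)
  next
    case False
    then show ?thesis
      using x assms(2)[of i] hcomp_mem[of x i] by (auto simp: tail_eq)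
  qed
  moreover have "x \<in> carrier R"
    using x by (simp add: tail_eq)
  ultimately show "x \<in> H"
    using mem_if_hcomp_mem[OF assms(1)] by blast
qed

lemma tail_ideal:
  assumes r: "r \<in> carrier R" and x: "x \<in> tail R A n"
  shows "r \<otimes> x \<in> tail R A n"
proof -
  have "tail R A n \<subseteq> {x \<in> carrier R. r \<otimes> x \<in> tail R A n}"
  proof (rule tail_subset_if_homogeneous)
    show "additive_subgroup {x \<in> carrier R. r \<otimes> x \<in> tail R A n} R"
      using r by (intro additive_subgroup_vimage_mult tail_subgroup additive_subgroup_carrier)
    show "A i \<subseteq> {x \<in> carrier R. r \<otimes> x \<in> tail R A n}" if "n \<le> i" for i
      using that r by (auto simp: tail_eq hcomp_mult_right component_carrier)
  qed
  then show ?thesis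
    using x by auto
qed

end

section \<open>Opposite rings\<close>

lemma opposite_ring_simps [simp]:
  "carrier (opposite_ring R) = carrier R" "\<zero>\<^bsub>opposite_ring R\<^esub> = \<zero>\<^bsub>R\<^esub>"
  "\<one>\<^bsub>opposite_ring R\<^esub> = \<one>\<^bsub>R\<^esub>" "x \<oplus>\<^bsub>opposite_ring R\<^esub> y = x \<oplus>\<^bsub>R\<^esub> y"
  "x \<otimes>\<^bsub>opposite_ring R\<^esub> y = y \<otimes>\<^bsub>R\<^esub> x" "add (opposite_ring R) = add R"
  by (simp_all add: opposite_ring_def)

lemma finsum_opposite_ring [simp]: "finsum (opposite_ring R) = finsum R"
  by (simp add: finsum_def)

lemma additive_subgroup_opposite_ring [simp]:
  "additive_subgroup H (opposite_ring R) \<longleftrightarrow> additive_subgroup H R"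
  by (simp add: additive_subgroup_def)

lemma (in ring) ring_opposite: "ring (opposite_ring R)"
proof (rule ringI)
  show "abelian_group (opposite_ring R)"
    using abelian_group_axioms
    by (simp add: abelian_group_def abelian_monoid_def abelian_group_axioms_def)
  show "Group.monoid (opposite_ring R)"
    by (rule monoidI) (auto simp: m_assoc)
qed (auto simp: l_distr r_distr)

lemma (in graded_ring) graded_ring_opposite: "graded_ring (opposite_ring R) A"
proof (intro graded_ring.intro graded_ring_axioms.intro)
  show "ring (opposite_ring R)"
    by (rule ring_opposite)
  fix x i y j assume "x \<in> A i" "y \<in> A j"
  then show "x \<otimes>\<^bsub>opposite_ring R\<^esub> y \<in> A (i + j)"
    using component_mult[of y j x i] by (simp add: add.commute[of j i])
qed (simp_all add: component_subgroup decomposition)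

section \<open>Finitely generated modules and graded homomorphisms\<close>

context ring
begin

text \<open>A sum in the module record refers to the carrier \<open>H\<close>. The record is an
  abelian group with the addition of \<open>R\<close>, so both sums obey the same recursion on
  finite sets.\<close>

lemma finsum_module_via:
  assumes H: "additive_subgroup H R" and "finite S" "f \<in> S \<rightarrow> H"
  shows "finsum ((module_via \<theta> R)\<lparr>carrier := H\<rparr>) f S = finsum R f S"
proof -
  let ?N = "(module_via \<theta> R)\<lparr>carrier := H\<rparr>"
  have carr: "x \<in> carrier R" if "x \<in> H" for x
    using H that by (rule additive_subgroup.a_Hcarr)
  have "abelian_group ?N"
  proof (rule abelian_groupI)
    fix x assume "x \<in> carrier ?N"
    then show "\<exists>y\<in>carrier ?N. y \<oplus>\<^bsub>?N\<^esub> x = \<zero>\<^bsub>?N\<^esub>"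
      using additive_subgroup.a_inv_closed[OF H, of x] carr[of x]
      by (auto simp: module_via_def l_neg intro!: bexI[of _ "\<ominus> x"])
  qed (use carr in \<open>auto simp: module_via_def a_ac additive_subgroup.a_closed[OF H]
    additive_subgroup.zero_closed[OF H]\<close>)
  then interpret N: abelian_group ?N .
  show ?thesis
    using assms(2,3)
  proof (induction S rule: finite_induct)
    case empty
    have "\<zero>\<^bsub>?N\<^esub> = \<zero>"
      by (simp add: module_via_def)
    then show ?case
      unfolding finsum_empty N.finsum_empty .
  next
    case (insert s S)
    have f: "f \<in> S \<rightarrow> H" "f s \<in> H" "f \<in> S \<rightarrow> carrier R" "f s \<in> carrier R"
      using insert.prems carr by auto
    have "carrier ?N = H" "add ?N = add R"
      by (simp_all add: module_via_def)
    then have "finsum ?N f (insert s S) = f s \<oplus> finsum ?N f S"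
      using N.finsum_insert[of S s f] insert.hyps f by metis
    then show ?case
      using insert f by simp
  qed
qed

text \<open>Because \<open>C\<close> is a subring, coefficients can be collected: linear
  combinations over a finite set are closed under addition and negation by distributivity.\<close>

lemma lspan_eq_finsums:
  assumes C: "subring C R" and S: "finite S" "S \<subseteq> carrier R"
  shows "lspan R C S = {\<Oplus>s\<in>S. c s \<otimes> s | c. c \<in> S \<rightarrow> C}"
proof
  have CR: "C \<subseteq> carrier R"
    using subringE(1)[OF C] .
  let ?T = "{\<Oplus>s\<in>S. c s \<otimes> s | c. c \<in> S \<rightarrow> C}"
  have carr: "(\<lambda>s. c s \<otimes> s) \<in> S \<rightarrow> carrier R" if "c \<in> S \<rightarrow> C" for c
    using that CR S(2) by (auto simp: Pi_iff subset_iff)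
  show "?T \<subseteq> lspan R C S"
    using lspan_subgroup[OF CR S(2)]
    by (auto simp: Pi_iff intro!: additive_subgroup_finsum lspan_mult)
  show "lspan R C S \<subseteq> ?T"
  proof (rule lspan_subset)
    have add: "x \<oplus> y \<in> ?T" if xy: "x \<in> ?T" "y \<in> ?T" for x y
    proof -
      obtain c d where c: "c \<in> S \<rightarrow> C" "x = (\<Oplus>s\<in>S. c s \<otimes> s)"
        and d: "d \<in> S \<rightarrow> C" "y = (\<Oplus>s\<in>S. d s \<otimes> s)"
        using xy by auto
      have "x \<oplus> y = (\<Oplus>s\<in>S. c s \<otimes> s \<oplus> d s \<otimes> s)"
        using c d carr by (simp add: finsum_addf)
      also have "\<dots> = (\<Oplus>s\<in>S. (c s \<oplus> d s) \<otimes> s)"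
        using c(1) d(1) CR S(2) by (intro finsum_cong') (auto simp: l_distr Pi_iff subset_iff)
      finally show ?thesis
        using c d subringE(7)[OF C] by (intro CollectI exI[of _ "\<lambda>s. c s \<oplus> d s"]) (auto simp: Pi_iff)
    qed
    have neg: "\<ominus> x \<in> ?T" if x: "x \<in> ?T" for x
    proof -
      obtain c where c: "c \<in> S \<rightarrow> C" "x = (\<Oplus>s\<in>S. c s \<otimes> s)"
        using x by auto
      have c': "(\<lambda>s. \<ominus> c s) \<in> S \<rightarrow> C"
        using c subringE(5)[OF C] by (auto simp: Pi_iff)
      have "(\<Oplus>s\<in>S. (\<ominus> c s) \<otimes> s) \<oplus> x = (\<Oplus>s\<in>S. (\<ominus> c s) \<otimes> s \<oplus> c s \<otimes> s)"
        using c carr[OF c'] carr[OF c(1)] by (simp add: finsum_addf)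
      also have "\<dots> = (\<Oplus>s\<in>S. \<zero>)"
        using c(1) CR S(2)
        by (intro finsum_cong') (auto simp: Pi_iff subset_iff l_minus l_neg)
      finally have "(\<Oplus>s\<in>S. (\<ominus> c s) \<otimes> s) \<oplus> x = \<zero>"
        by simp
      then have "\<ominus> x = (\<Oplus>s\<in>S. (\<ominus> c s) \<otimes> s)"
        using carr[OF c'] carr[OF c(1)] c(2) by (intro minus_equality) auto
      then show ?thesis
        using c' by (intro CollectI exI[of _ "\<lambda>s. \<ominus> c s"]) auto
    qed
    have "\<zero> = (\<Oplus>s\<in>S. \<zero> \<otimes> s)"
      using S(2) by (subst finsum_cong'[of S S "\<lambda>_. \<zero>"]) (auto simp: subset_iff)
    then have zero: "\<zero> \<in> ?T"
      using subringE(2)[OF C] by auto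
    have "?T \<subseteq> carrier R"
      using carr by auto
    then show "additive_subgroup ?T R"
      using add neg zero by (intro additive_subgroupI')
    fix c x assume c: "c \<in> C" and x: "x \<in> S"
    have cR: "c \<in> carrier R" and xR: "x \<in> carrier R"
      using c x CR S by auto
    \<comment> \<open>A single product is the combination whose coefficients are concentrated at
      \<open>x\<close>.\<close>
    have "(\<Oplus>s\<in>S. if x = s then c \<otimes> s else \<zero>) = c \<otimes> x"
      using finsum_singleton[OF x S(1), of "\<lambda>s. c \<otimes> s"] cR S by (auto simp: subset_iff)
    moreover have "(\<Oplus>s\<in>S. (if x = s then c else \<zero>) \<otimes> s)
        = (\<Oplus>s\<in>S. if x = s then c \<otimes> s else \<zero>)"
      using S cR by (intro finsum_cong') (auto simp: subset_iff)
    ultimately show "c \<otimes> x \<in> ?T"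
      using c subringE(2)[OF C]
      by (intro CollectI exI[of _ "\<lambda>s. if x = s then c else \<zero>"]) auto
  qed
qed

text \<open>The bridge from module records to spans. Scalars from \<open>Q\<close> act through their
  images under \<theta>, and coefficients in the image are lifted back to \<open>Q\<close> by
  choice.\<close>

lemma fin_gen_left_module_iff_finitely_spanned:
  assumes C: "subring (\<theta> ` carrier Q) R" and H: "left_submodule R (\<theta> ` carrier Q) H"
  shows "fin_gen_left_module Q ((module_via \<theta> R)\<lparr>carrier := H\<rparr>)
    \<longleftrightarrow> finitely_spanned R (\<theta> ` carrier Q) H"
proof -
  let ?C = "\<theta> ` carrier Q" and ?N = "(module_via \<theta> R)\<lparr>carrier := H\<rparr>"
  have Hadd: "additive_subgroup H R"
    using H by (simp add: left_submodule_def)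
  have HR: "H \<subseteq> carrier R"
    using Hadd by (rule additive_subgroup.a_subset)
  have span: "{\<Oplus>\<^bsub>?N\<^esub>s\<in>S. f s \<odot>\<^bsub>?N\<^esub> s | f. f \<in> S \<rightarrow> carrier Q} = lspan R ?C S"
    if S: "finite S" "S \<subseteq> H" for S
  proof -
    have eq: "(\<Oplus>\<^bsub>?N\<^esub>s\<in>S. f s \<odot>\<^bsub>?N\<^esub> s) = (\<Oplus>s\<in>S. \<theta> (f s) \<otimes> s)"
      if f: "f \<in> S \<rightarrow> carrier Q" for f
    proof -
      have "(\<lambda>s. \<theta> (f s) \<otimes> s) \<in> S \<rightarrow> H"
        using f S(2) H by (auto simp: left_submodule_def Pi_iff subset_iff)
      then have "finsum ?N (\<lambda>s. \<theta> (f s) \<otimes> s) S = (\<Oplus>s\<in>S. \<theta> (f s) \<otimes> s)"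
        using finsum_module_via[OF Hadd S(1)] by blast
      then show ?thesis
        by (simp add: module_via_def)
    qed
    have "{\<Oplus>\<^bsub>?N\<^esub>s\<in>S. f s \<odot>\<^bsub>?N\<^esub> s | f. f \<in> S \<rightarrow> carrier Q}
        = {\<Oplus>s\<in>S. \<theta> (f s) \<otimes> s | f. f \<in> S \<rightarrow> carrier Q}"
    proof (intro Collect_cong iffI; elim exE conjE)
      fix x f assume x: "x = (\<Oplus>\<^bsub>?N\<^esub>s\<in>S. f s \<odot>\<^bsub>?N\<^esub> s)" and f: "f \<in> S \<rightarrow> carrier Q"
      show "\<exists>f. x = (\<Oplus>s\<in>S. \<theta> (f s) \<otimes> s) \<and> f \<in> S \<rightarrow> carrier Q"
        using trans[OF x eq[OF f]] f by (intro exI[of _ f] conjI)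
    next
      fix x f assume x: "x = (\<Oplus>s\<in>S. \<theta> (f s) \<otimes> s)" and f: "f \<in> S \<rightarrow> carrier Q"
      show "\<exists>f. x = (\<Oplus>\<^bsub>?N\<^esub>s\<in>S. f s \<odot>\<^bsub>?N\<^esub> s) \<and> f \<in> S \<rightarrow> carrier Q"
        using trans[OF x eq[OF f, symmetric]] f by (intro exI[of _ f] conjI)
    qed
    also have "\<dots> = {\<Oplus>s\<in>S. c s \<otimes> s | c. c \<in> S \<rightarrow> ?C}"
    proof (intro equalityI subsetI)
      fix x assume "x \<in> {\<Oplus>s\<in>S. c s \<otimes> s | c. c \<in> S \<rightarrow> ?C}"
      then obtain c where c: "c \<in> S \<rightarrow> ?C" "x = (\<Oplus>s\<in>S. c s \<otimes> s)"
        by blast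
      then have "\<forall>s\<in>S. \<exists>q. q \<in> carrier Q \<and> c s = \<theta> q"
        by (auto simp: Pi_iff)
      then obtain f where f: "\<forall>s\<in>S. f s \<in> carrier Q \<and> c s = \<theta> (f s)"
        by (rule bchoice[THEN exE])
      have "x = (\<Oplus>s\<in>S. \<theta> (f s) \<otimes> s)"
        unfolding c(2) using f S(2) HR subringE(1)[OF C]
        by (intro finsum_cong') (auto simp: subset_iff)
      then show "x \<in> {\<Oplus>s\<in>S. \<theta> (f s) \<otimes> s | f. f \<in> S \<rightarrow> carrier Q}"
        using f by (intro CollectI exI[of _ f]) auto
    next
      fix x assume "x \<in> {\<Oplus>s\<in>S. \<theta> (f s) \<otimes> s | f. f \<in> S \<rightarrow> carrier Q}"
      then obtain f where "f \<in> S \<rightarrow> carrier Q" "x = (\<Oplus>s\<in>S. \<theta> (f s) \<otimes> s)"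
        by blast
      then show "x \<in> {\<Oplus>s\<in>S. c s \<otimes> s | c. c \<in> S \<rightarrow> ?C}"
        by (intro CollectI exI[of _ "\<lambda>s. \<theta> (f s)"]) auto
    qed
    also have "\<dots> = lspan R ?C S"
      using lspan_eq_finsums[OF C S(1)] S(2) HR by auto
    finally show ?thesis .
  qed
  show ?thesis
  proof
    assume "fin_gen_left_module Q ?N"
    then obtain S where S: "finite S" "S \<subseteq> H"
      and HS: "H = {\<Oplus>\<^bsub>?N\<^esub>s\<in>S. f s \<odot>\<^bsub>?N\<^esub> s | f. f \<in> S \<rightarrow> carrier Q}"
      unfolding fin_gen_left_module_def by auto
    have "H = lspan R ?C S"
      using HS span[OF S] by (rule trans)
    then show "finitely_spanned R ?C H"
      unfolding finitely_spanned_def using S HR by (intro exI[of _ S] conjI) auto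
  next
    assume "finitely_spanned R ?C H"
    then obtain S where S: "finite S" "S \<subseteq> carrier R" "H = lspan R ?C S"
      unfolding finitely_spanned_def by auto
    have SH: "S \<subseteq> H"
      using S lspan_superset[OF subringE(3)[OF C] S(2)] by simp
    have carr: "carrier ?N = H"
      by simp
    show "fin_gen_left_module Q ?N"
      unfolding fin_gen_left_module_def carr
      using S(1) SH trans[OF S(3) span[OF S(1) SH, symmetric]] by (intro exI[of _ S] conjI)
  qed
qed

lemma additive_subgroup_restrict:
  assumes "additive_subgroup K R" "additive_subgroup H R" "K \<subseteq> H"
  shows "additive_subgroup K (R\<lparr>carrier := H\<rparr>)"
  using add.subgroup_incl[of K H] assms by (simp add: additive_subgroup_def)

lemma left_noetherian_iff: "left_noetherian R \<longleftrightarrow> left_noetherian_subring R (carrier R)"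
proof -
  have sub: "subring (id ` carrier R) R"
    using carrier_is_subring by simp
  have "left_ideal I R \<longleftrightarrow> I \<subseteq> carrier R \<and> left_submodule R (carrier R) I" for I
    by (auto simp: left_ideal_def left_submodule_def dest: additive_subgroup.a_subset)
  then show ?thesis
    using fin_gen_left_module_iff_finitely_spanned[OF sub]
    by (simp add: left_noetherian_def left_noetherian_subring_def left_regular_def)
qed

end

section \<open>The degree-zero subring\<close>

lemma degree_zero_simps [simp]: "carrier (degree_zero R A) = A 0"
  "x \<otimes>\<^bsub>degree_zero R A\<^esub> y = x \<otimes>\<^bsub>R\<^esub> y"
  by (simp_all add: degree_zero_def)

text \<open>The two regular modules differ only in the carrier, which is overwritten by
  \<open>H\<close>.\<close>

lemma left_regular_degree_zero [simp]:
  "(left_regular (degree_zero R A))\<lparr>carrier := H\<rparr> = (left_regular R)\<lparr>carrier := H\<rparr>"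
  by (simp add: left_regular_def module_via_def degree_zero_def)

lemma opposite_ring_degree_zero:
  "opposite_ring (degree_zero R A) = degree_zero (opposite_ring R) A"
  by (simp add: opposite_ring_def degree_zero_def)

lemma (in graded_ring) fin_gen_degree_zero_iff:
  assumes "left_submodule R (A 0) H"
  shows "fin_gen_left_module (degree_zero R A) ((left_regular R)\<lparr>carrier := H\<rparr>)
    \<longleftrightarrow> finitely_spanned R (A 0) H"
  using fin_gen_left_module_iff_finitely_spanned[of id "degree_zero R A" H] assms
    subring_component_zero
  by (simp add: left_regular_def)

lemma (in graded_ring) left_submodule_component: "left_submodule R (A 0) (A i)"
  using component_subgroup component_mult[of _ 0 _ i] by (auto simp: left_submodule_def)

lemma (in graded_ring) left_noetherian_component_zero:
  assumes "left_noetherian (degree_zero R A)"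
  shows "left_noetherian_subring R (A 0)"
  unfolding left_noetherian_subring_def
proof (intro allI impI, elim conjE)
  fix K assume K: "K \<subseteq> A 0" "left_submodule R (A 0) K"
  then have "left_ideal K (degree_zero R A)"
    using additive_subgroup_restrict[OF _ component_subgroup[of 0] K(1)]
    by (simp add: left_ideal_def left_submodule_def) (simp add: degree_zero_def)
  then show "finitely_spanned R (A 0) K"
    using assms fin_gen_degree_zero_iff[OF K(2)] by (auto simp: left_noetherian_def)
qed

section \<open>Graded ring homomorphisms\<close>

locale graded_hom = R: graded_ring R A + M: graded_ring M B
  for R :: "('a, 'k) ring_scheme" (structure) and A and M :: "('b, 'l) ring_scheme" and B +
  fixes \<theta> :: "'a \<Rightarrow> 'b"
  assumes hom: "\<theta> \<in> graded_ring_hom R A M B"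
begin

abbreviation image_ring where "image_ring \<equiv> \<theta> ` carrier R"

lemma hom_in_ring_hom: "\<theta> \<in> ring_hom R M"
  using hom by (simp add: graded_ring_hom_def)

lemma hom_closed [simp]: "x \<in> carrier R \<Longrightarrow> \<theta> x \<in> carrier M"
  using ring_hom_closed[OF hom_in_ring_hom] .

lemma hom_component: "x \<in> A i \<Longrightarrow> \<theta> x \<in> B i"
  using hom by (auto simp: graded_ring_hom_def)

lemma image_subset: "image_ring \<subseteq> carrier M"
  by auto

sublocale ring_hom_ring R M \<theta>
  using hom_in_ring_hom by unfold_locales (auto simp: ring_hom_def)

lemma subring_image: "subring image_ring M"
  using img_is_subring[OF R.carrier_is_subring] .

lemma hcomp_hom:
  assumes x: "x \<in> carrier R"
  shows "M.hc i (\<theta> x) = \<theta> (R.hc i x)"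
proof -
  have "carrier R \<subseteq> {x \<in> carrier R. \<forall>i. M.hc i (\<theta> x) = \<theta> (R.hc i x)}"
  proof (rule R.carrier_subset_if_homogeneous)
    show "additive_subgroup {x \<in> carrier R. \<forall>i. M.hc i (\<theta> x) = \<theta> (R.hc i x)} R"
      by (intro R.additive_subgroupI')
        (auto simp: M.hcomp_add R.hcomp_add M.hcomp_a_inv R.hcomp_a_inv)
    show "A j \<subseteq> {x \<in> carrier R. \<forall>i. M.hc i (\<theta> x) = \<theta> (R.hc i x)}" for j
      by (auto simp: R.component_carrier R.hcomp_homogeneous M.hcomp_homogeneous[OF hom_component])
  qed
  then show ?thesis
    using x by auto
qed

lemma hom_tail: "x \<in> tail R A n \<Longrightarrow> \<theta> x \<in> tail M B n"
  by (auto simp: R.tail_eq M.tail_eq hcomp_hom)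

text \<open>In degree \<open>d\<close>, a product of \<open>r\<close> with a generator of degree
  \<open>i\<close> contributes only through the component of \<open>r\<close> of degree
  \<open>d - i\<close>. A homogeneous element of the span is therefore a combination with
  homogeneous coefficients.\<close>

lemma homogeneous_in_lspan:
  assumes G: "\<And>i. G i \<subseteq> B i" and x: "x \<in> B d" "x \<in> lspan M image_ring (\<Union>i\<in>I. G i)"
  shows "x \<in> additive_span M {\<theta> r \<otimes>\<^bsub>M\<^esub> f | r f i. i \<in> I \<and> i \<le> d \<and> r \<in> A (d - i) \<and> f \<in> G i}"
    (is "_ \<in> ?S")
proof -
  have GM: "f \<in> carrier M" if "f \<in> G i" for f i
    using that G M.component_carrier by blast
  have S: "additive_subgroup ?S M"
    by (intro M.additive_span_subgroup)
      (auto intro!: M.m_closed simp: R.component_carrier GM)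
  have "lspan M image_ring (\<Union>i\<in>I. G i) \<subseteq> {x \<in> carrier M. \<forall>e\<in>{d}. M.hc e x \<in> ?S}"
  proof (rule M.lspan_subset)
    show "additive_subgroup {x \<in> carrier M. \<forall>e\<in>{d}. M.hc e x \<in> ?S} M"
      using S by (rule M.additive_subgroup_vimage_hcomp)
    fix c f assume "c \<in> image_ring" and f: "f \<in> (\<Union>i\<in>I. G i)"
    then obtain r where r: "r \<in> carrier R" "c = \<theta> r"
      by auto
    obtain i where i: "i \<in> I" "f \<in> G i" "f \<in> B i"
      using f G by auto
    have "M.hc d (\<theta> r \<otimes>\<^bsub>M\<^esub> f) \<in> ?S"
    proof (cases "i \<le> d")
      case True
      have "\<theta> (R.hc (d - i) r) \<otimes>\<^bsub>M\<^esub> f \<in> ?S"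
        by (rule subsetD[OF M.additive_span_superset])
          (use True i r R.hcomp_mem in blast)
      then show ?thesis
        using True i r by (simp add: M.hcomp_mult_right hcomp_hom)
    next
      case False
      then show ?thesis
        using i r additive_subgroup.zero_closed[OF S] by (simp add: M.hcomp_mult_right)
    qed
    then show "c \<otimes>\<^bsub>M\<^esub> f \<in> {x \<in> carrier M. \<forall>e\<in>{d}. M.hc e x \<in> ?S}"
      using r i by (simp add: M.component_carrier)
  qed
  then have "M.hc d x \<in> ?S"
    using x(2) by auto
  then show ?thesis
    using x(1) by (simp add: M.hcomp_homogeneous)
qed

end

text \<open>Makes results about modules over a graded ring applicable to the ring itself.\<close>

lemma (in graded_ring) graded_hom_id: "graded_hom R A R A id"
  by unfold_locales (auto simp: graded_ring_hom_def ring_hom_def)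

section \<open>Isomorphisms of tails\<close>

locale graded_tail_iso = R: graded_ring R A + S: graded_ring S B
  for R :: "('a, 'k) ring_scheme" (structure) and A and S :: "('b, 'l) ring_scheme" and B +
  fixes n :: nat and h :: "'a \<Rightarrow> 'b"
  assumes iso: "h \<in> graded_rng_iso (tail_rng R A n) (tail_component R A n)
                                  (tail_rng S B n) (tail_component S B n)"
begin

lemma iso_bij: "bij_betw h (tail R A n) (tail S B n)"
  using iso by (simp add: graded_rng_iso_def tail_rng_def)

lemma iso_closed: "x \<in> tail R A n \<Longrightarrow> h x \<in> tail S B n"
  using bij_betwE[OF iso_bij] by blast

lemma iso_add: "x \<in> tail R A n \<Longrightarrow> y \<in> tail R A n \<Longrightarrow> h (x \<oplus> y) = h x \<oplus>\<^bsub>S\<^esub> h y"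
  using iso by (simp add: graded_rng_iso_def tail_rng_def hom_def)

lemma iso_mult: "x \<in> tail R A n \<Longrightarrow> y \<in> tail R A n \<Longrightarrow> h (x \<otimes> y) = h x \<otimes>\<^bsub>S\<^esub> h y"
  using iso by (simp add: graded_rng_iso_def tail_rng_def hom_def)

lemma iso_component:
  assumes "n \<le> i" "x \<in> A i"
  shows "h x \<in> B i"
proof -
  have "h ` tail_component R A n i \<subseteq> tail_component S B n i"
    using iso by (simp add: graded_rng_iso_def)
  then show ?thesis
    using assms by (auto simp: tail_component_def)
qed

lemma R_tail_carrier: "x \<in> tail R A n \<Longrightarrow> x \<in> carrier R"
  by (simp add: R.tail_eq)

lemma S_tail_carrier: "x \<in> tail S B n \<Longrightarrow> x \<in> carrier S"
  by (simp add: S.tail_eq)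

lemma iso_zero: "h \<zero> = \<zero>\<^bsub>S\<^esub>"
proof -
  have z: "\<zero> \<in> tail R A n"
    using additive_subgroup.zero_closed[OF R.tail_subgroup] .
  have "h \<zero> \<oplus>\<^bsub>S\<^esub> h \<zero> = h \<zero>"
    using iso_add[OF z z] by simp
  then show ?thesis
    using S_tail_carrier[OF iso_closed[OF z]] by (metis S.add.l_cancel_one')
qed

lemma iso_a_inv:
  assumes x: "x \<in> tail R A n"
  shows "h (\<ominus> x) = \<ominus>\<^bsub>S\<^esub> h x"
proof -
  have x': "\<ominus> x \<in> tail R A n"
    using additive_subgroup.a_inv_closed[OF R.tail_subgroup x] .
  have "h (\<ominus> x) \<oplus>\<^bsub>S\<^esub> h x = \<zero>\<^bsub>S\<^esub>"
    using iso_add[OF x' x] R_tail_carrier[OF x] iso_zero by (simp add: R.l_neg)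
  then show ?thesis
    using S_tail_carrier[OF iso_closed[OF x]] S_tail_carrier[OF iso_closed[OF x']]
    by (simp add: S.minus_equality)
qed

text \<open>\<open>h\<close> is known to be additive on the tail only, hence the restriction to
  \<open>K\<close> inside it.\<close>

lemma additive_subgroup_vimage_iso:
  assumes "additive_subgroup K R" "K \<subseteq> tail R A n" "additive_subgroup H S"
  shows "additive_subgroup {x \<in> K. h x \<in> H} R"
  using assms
  by (intro R.additive_subgroupI')
    (auto simp: iso_zero iso_add iso_a_inv subset_iff additive_subgroup.a_Hcarr
      additive_subgroup.zero_closed additive_subgroup.a_closed additive_subgroup.a_inv_closed)

lemma hcomp_in_tail: "x \<in> tail R A n \<Longrightarrow> R.hc i x \<in> tail R A n"
  by (auto simp: R.tail_eq R.hcomp_homogeneous[OF R.hcomp_mem])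

lemma hcomp_iso:
  assumes x: "x \<in> tail R A n"
  shows "S.hc i (h x) = h (R.hc i x)"
proof -
  have "tail R A n \<subseteq> {x \<in> tail R A n. \<forall>i. S.hc i (h x) = h (R.hc i x)}" (is "_ \<subseteq> ?H")
  proof (rule R.tail_subset_if_homogeneous)
    show "additive_subgroup ?H R"
      using additive_subgroup.zero_closed[OF R.tail_subgroup, of n]
        additive_subgroup.a_closed[OF R.tail_subgroup, of _ n]
        additive_subgroup.a_inv_closed[OF R.tail_subgroup, of _ n]
      by (intro R.additive_subgroupI')
        (auto simp: R_tail_carrier S_tail_carrier iso_closed hcomp_in_tail iso_zero iso_add
          iso_a_inv R.hcomp_add S.hcomp_add R.hcomp_a_inv S.hcomp_a_inv)
    show "A j \<subseteq> ?H" if j: "n \<le> j" for j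
      using R.component_subset_tail[OF j]
      by (auto simp: R.hcomp_homogeneous S.hcomp_homogeneous[OF iso_component[OF j]] iso_zero)
  qed
  then show ?thesis
    using x by auto
qed

section \<open>The inverse isomorphism\<close>

abbreviation iso_inv where "iso_inv \<equiv> inv_into (tail R A n) h"

lemma iso_inv_closed: "y \<in> tail S B n \<Longrightarrow> iso_inv y \<in> tail R A n"
  and iso_iso_inv: "y \<in> tail S B n \<Longrightarrow> h (iso_inv y) = y"
  using iso_bij by (auto simp: bij_betw_def inv_into_into f_inv_into_f)

lemma iso_inv_eqI: "x \<in> tail R A n \<Longrightarrow> h x = y \<Longrightarrow> iso_inv y = x"
  using iso_bij by (auto simp: bij_betw_def)

text \<open>A graded isomorphism is only required to map components into components. For the
  inverse, the preimage of \<open>y\<close> and its component of degree \<open>i\<close> have the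
  same image under \<open>h\<close>, so they coincide by injectivity.\<close>

lemma iso_inv_component:
  assumes i: "n \<le> i" and y: "y \<in> B i"
  shows "iso_inv y \<in> A i"
proof -
  let ?x = "iso_inv y"
  have yt: "y \<in> tail S B n"
    using S.component_subset_tail[OF i] y by auto
  note x = iso_inv_closed[OF yt]
  have "h (R.hc i ?x) = h ?x"
    using hcomp_iso[OF x, of i] iso_iso_inv[OF yt] S.hcomp_homogeneous[OF y, of i] by simp
  then have "R.hc i ?x = ?x"
    using iso_bij x hcomp_in_tail[OF x] by (auto simp: bij_betw_def dest: inj_onD)
  then show ?thesis
    using R.hcomp_mem[of ?x i] x R_tail_carrier by simp
qed

lemma graded_tail_iso_inv: "graded_tail_iso S B R A n iso_inv"
proof
  have add: "iso_inv (x \<oplus>\<^bsub>S\<^esub> y) = iso_inv x \<oplus> iso_inv y"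
    if "x \<in> tail S B n" "y \<in> tail S B n" for x y
    using that iso_inv_closed[of x] iso_inv_closed[of y]
    by (intro iso_inv_eqI)
      (auto simp: iso_add iso_iso_inv additive_subgroup.a_closed[OF R.tail_subgroup])
  have mult: "iso_inv (x \<otimes>\<^bsub>S\<^esub> y) = iso_inv x \<otimes> iso_inv y"
    if "x \<in> tail S B n" "y \<in> tail S B n" for x y
    using that iso_inv_closed[of x] iso_inv_closed[of y]
    by (intro iso_inv_eqI) (auto simp: iso_mult iso_iso_inv R.tail_ideal R_tail_carrier)
  have "iso_inv \<zero>\<^bsub>S\<^esub> = \<zero>"
    using additive_subgroup.zero_closed[OF R.tail_subgroup] by (intro iso_inv_eqI iso_zero)
  then show "iso_inv \<in> graded_rng_iso (tail_rng S B n) (tail_component S B n)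
      (tail_rng R A n) (tail_component R A n)"
    using bij_betw_inv_into[OF iso_bij] add mult iso_inv_closed iso_inv_component
    by (auto simp: graded_rng_iso_def tail_rng_def tail_component_def hom_def)
qed

lemma graded_tail_iso_opposite:
  "graded_tail_iso (opposite_ring R) A (opposite_ring S) B n h"
proof (intro graded_tail_iso.intro graded_tail_iso_axioms.intro)
  show "graded_ring (opposite_ring R) A" "graded_ring (opposite_ring S) B"
    by (rule R.graded_ring_opposite S.graded_ring_opposite)+
  have "tail (opposite_ring R) A n = tail R A n" "tail (opposite_ring S) B n = tail S B n"
    by (simp_all add: tail_def)
  then show "h \<in> graded_rng_iso (tail_rng (opposite_ring R) A n)
      (tail_component (opposite_ring R) A n)
      (tail_rng (opposite_ring S) B n) (tail_component (opposite_ring S) B n)"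
    using iso iso_component iso_zero
    by (simp add: graded_rng_iso_def tail_rng_def tail_component_def hom_def image_subset_iff)
qed

end

section \<open>Compatible isomorphisms of tails\<close>

locale graded_tail_square =
  src: graded_hom R A M B \<theta> + tgt: graded_hom R' A' M' B' \<theta>' +
  ring_iso: graded_tail_iso R A R' A' n \<phi> + mod_iso: graded_tail_iso M B M' B' n \<psi>
  for R :: "('a, 'k) ring_scheme" and A and M :: "('b, 'l) ring_scheme" and B and \<theta>
    and R' :: "('c, 'm) ring_scheme" and A' and M' :: "('d, 'n) ring_scheme" and B' and \<theta>'
    and n \<phi> \<psi> +
  assumes compat: "x \<in> tail R A n \<Longrightarrow> \<psi> (\<theta> x) = \<theta>' (\<phi> x)"
begin

text \<open>
  The bound \<open>N + n \<le> d\<close> makes every coefficient of a generator of degree at most \<open>N\<close> lie in the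
  tail, where \<open>\<phi>\<close> is defined.
\<close>

lemma transport_homogeneous:
  assumes G: "\<And>i. G i \<subseteq> B i" and d: "N + n \<le> d"
    and x: "x \<in> B d" "x \<in> lspan M src.image_ring (\<Union>i\<in>{n..N}. G i)"
  shows "\<psi> x \<in> additive_span M'
    {\<theta>' r \<otimes>\<^bsub>M'\<^esub> \<psi> f | r f i. i \<in> {n..N} \<and> r \<in> A' (d - i) \<and> f \<in> G i}" (is "_ \<in> ?S")
proof -
  have Bd: "B d \<subseteq> tail M B n"
    using d by (intro src.M.component_subset_tail) simp
  have GM: "f \<in> tail M B n" if "f \<in> G i" "n \<le> i" for f i
    using that G src.M.component_subset_tail by blast
  have "\<theta>' r \<otimes>\<^bsub>M'\<^esub> \<psi> f \<in> carrier M'" if "i \<in> {n..N}" "r \<in> A' (d - i)" "f \<in> G i" for r f i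
    using that GM[of f i] mod_iso.S_tail_carrier mod_iso.iso_closed tgt.R.component_carrier
    by auto
  then have S: "additive_subgroup ?S M'"
    by (intro tgt.M.additive_span_subgroup) auto
  \<comment> \<open>The additive argument is carried out inside \<open>B d\<close>, which lies in
    the tail, where \<psi> is additive.\<close>
  have "additive_span M {\<theta> r \<otimes>\<^bsub>M\<^esub> f | r f i. i \<in> {n..N} \<and> i \<le> d \<and> r \<in> A (d - i) \<and> f \<in> G i}
      \<subseteq> {x \<in> B d. \<psi> x \<in> ?S}"
  proof (rule src.M.additive_span_least)
    show "additive_subgroup {x \<in> B d. \<psi> x \<in> ?S} M"
      using src.M.component_subgroup Bd S by (rule mod_iso.additive_subgroup_vimage_iso)
    show "{\<theta> r \<otimes>\<^bsub>M\<^esub> f | r f i. i \<in> {n..N} \<and> i \<le> d \<and> r \<in> A (d - i) \<and> f \<in> G i}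
      \<subseteq> {x \<in> B d. \<psi> x \<in> ?S}"
    proof
      fix v assume "v \<in> {\<theta> r \<otimes>\<^bsub>M\<^esub> f | r f i. i \<in> {n..N} \<and> i \<le> d \<and> r \<in> A (d - i) \<and> f \<in> G i}"
      then obtain r f i where v: "v = \<theta> r \<otimes>\<^bsub>M\<^esub> f"
        and i: "n \<le> i" "i \<le> N" "i \<le> d" and r: "r \<in> A (d - i)" and f: "f \<in> G i"
        by auto
      have "n \<le> d - i"
        using i d by simp
      then have rt: "r \<in> tail R A n" and r': "\<phi> r \<in> A' (d - i)"
        using r src.R.component_subset_tail ring_iso.iso_component by auto
      have "v \<in> B ((d - i) + i)"
        unfolding v using r f G by (intro src.M.component_mult src.hom_component) auto
      \<comment> \<open>Both factors lie in the tail of \<open>M\<close>, so \<psi> is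
        multiplicative on them.\<close>
      moreover have "\<psi> v = \<theta>' (\<phi> r) \<otimes>\<^bsub>M'\<^esub> \<psi> f"
        using v rt f i by (simp add: mod_iso.iso_mult src.hom_tail GM compat)
      then have "\<psi> v \<in> ?S"
        using i r' f by (intro subsetD[OF tgt.M.additive_span_superset]) auto
      ultimately show "v \<in> {x \<in> B d. \<psi> x \<in> ?S}"
        using i by simp
    qed
  qed
  then show ?thesis
    using src.homogeneous_in_lspan[OF G x] by auto
qed

end

section \<open>Transfer of finiteness\<close>

lemma finite_subset_UN_bounded:
  fixes G :: "nat \<Rightarrow> 'a set"
  assumes "finite F" "F \<subseteq> (\<Union>i\<in>I. G i)"
  obtains N where "F \<subseteq> (\<Union>i\<in>I \<inter> {..N}. G i)"
proof -
  have "\<forall>f\<in>F. \<exists>i. i \<in> I \<and> f \<in> G i"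
    using assms(2) by blast
  then obtain deg where deg: "\<forall>f\<in>F. deg f \<in> I \<and> f \<in> G (deg f)"
    by (rule bchoice[THEN exE])
  obtain N where "\<forall>i\<in>deg ` F. i \<le> N"
    using assms(1) finite_nat_set_iff_bounded_le[of "deg ` F"] by auto
  then have "F \<subseteq> (\<Union>i\<in>I \<inter> {..N}. G i)"
    using deg by auto
  then show ?thesis
    by (rule that)
qed

context graded_ring
begin

text \<open>The bound is strict, so degree at most \<open>d\<close> reads
  \<open>below (Suc d)\<close>. Writing vanishing as membership in \<open>{\<zero>}\<close> makes
  this an instance of \<open>additive_subgroup_vimage_hcomp\<close>.\<close>

definition below :: "nat \<Rightarrow> 'a set" where
  "below d = {x \<in> carrier R. \<forall>i\<in>{d..}. hc i x \<in> {\<zero>}}"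

lemma below_iff: "x \<in> below d \<longleftrightarrow> x \<in> carrier R \<and> (\<forall>i\<ge>d. hc i x = \<zero>)"
  by (auto simp: below_def)

lemma below_subgroup: "additive_subgroup (below d) R"
  unfolding below_def using additive_subgroup_zero by (rule additive_subgroup_vimage_hcomp)

lemma below_mono: "d \<le> e \<Longrightarrow> below d \<subseteq> below e"
  by (auto simp: below_iff)

lemma ex_below:
  assumes "x \<in> carrier R"
  shows "\<exists>d. x \<in> below d"
proof -
  obtain d where "\<forall>i\<in>{i. hc i x \<noteq> \<zero>}. i < d"
    using finite_hcomp_support[OF assms] finite_nat_set_iff_bounded by blast
  then have "x \<in> below d"
    using assms by (auto simp: below_iff)
  then show ?thesis ..
qed

text \<open>Multiplication by a homogeneous element shifts all degrees by \<open>j\<close>, so the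
  component at the top admissible degree is multiplied by \<open>r\<close>.\<close>

lemma hcomp_mult_below:
  assumes r: "r \<in> A j" and y: "y \<in> below (Suc i)"
  shows "r \<otimes> y \<in> below (Suc (j + i))" "hc (j + i) (r \<otimes> y) = r \<otimes> hc i y"
  using assms component_carrier[OF r] by (auto simp: below_iff hcomp_mult_left[OF r])

lemma left_submodule_below: "left_submodule R (A 0) (below d)"
  unfolding left_submodule_def
  using below_subgroup component_carrier
  by (auto simp: below_iff hcomp_mult_left[of _ 0])

lemma below_subset_lspan:
  assumes "\<And>i. finitely_spanned R (A 0) (A i)"
  obtains S where "finite S" "S \<subseteq> carrier R" "below d \<subseteq> lspan R (A 0) S"
proof -
  obtain g where g: "\<And>i. finite (g i) \<and> g i \<subseteq> carrier R \<and> A i = lspan R (A 0) (g i)"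
    using assms unfolding finitely_spanned_def by metis
  let ?S = "\<Union>i<d. g i"
  have S: "finite ?S" "?S \<subseteq> carrier R"
    using g by auto
  have sub: "additive_subgroup (lspan R (A 0) ?S) R"
    using component_subset S(2) by (rule lspan_subgroup)
  have "below d \<subseteq> lspan R (A 0) ?S"
  proof
    fix x assume x: "x \<in> below d"
    have "hc i x \<in> lspan R (A 0) ?S" for i
    proof (cases "i < d")
      case True
      then have "lspan R (A 0) (g i) \<subseteq> lspan R (A 0) ?S"
        using component_subset S(2) by (intro lspan_mono) auto
      then show ?thesis
        using g[of i] hcomp_mem[of x i] x by (auto simp: below_iff)
    next
      case False
      then show ?thesis
        using x sub by (simp add: below_iff additive_subgroup.zero_closed)
    qed
    moreover have "x \<in> carrier R"
      using x by (simp add: below_iff)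
    ultimately show "x \<in> lspan R (A 0) ?S"
      using mem_if_hcomp_mem[OF sub] by blast
  qed
  with S that show ?thesis
    by blast
qed

end

section \<open>Transfer of left noetherianity and of finite generation\<close>

lemma (in graded_tail_iso) left_noetherian_transfer:
  assumes noeth: "left_noetherian_subring R (carrier R)"
    and noeth_zero: "left_noetherian_subring S (B 0)"
    and components: "\<And>i. finitely_spanned S (B 0) (B i)"
  shows "left_noetherian_subring S (carrier S)"
  unfolding left_noetherian_subring_def
proof (intro allI impI, elim conjE)
  fix J assume JS: "J \<subseteq> carrier S" and J: "left_submodule S (carrier S) J"
  \<comment> \<open>With identity homomorphisms, the transport of generation statements applies to
    the rings themselves.\<close>
  interpret sq: graded_tail_square R A R A id S B S B id n h h
    by (intro graded_tail_square.intro R.graded_hom_id S.graded_hom_id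
        graded_tail_iso_axioms graded_tail_square_axioms.intro) simp
  have Jadd: "additive_subgroup J S"
    using J by (simp add: left_submodule_def)
  \<comment> \<open>\<open>lead d\<close> collects the leading forms of degree \<open>d\<close> of
    elements of \<open>J\<close>, together with zero. \<open>G\<close> pulls them back along
    \<open>h\<close>; it is used in degrees at least \<open>n\<close> only, where \<open>h\<close>
    is controlled.\<close>
  define lead where "lead d = {S.hc d y | y. y \<in> J \<inter> S.below (Suc d)}" for d
  define G where "G i = {x \<in> A i. h x \<in> lead i}" for i
  have GR: "(\<Union>i\<in>I. G i) \<subseteq> carrier R" for I
    using R.component_carrier by (auto simp: G_def)
  have "left_submodule R (carrier R) (lspan R (carrier R) (\<Union>i\<in>{n..}. G i))"
    using GR by (intro R.lspan_submodule R.carrier_is_subring)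
  then have "finitely_spanned R (carrier R) (lspan R (carrier R) (\<Union>i\<in>{n..}. G i))"
    using noeth R.lspan_carrier[OF subset_refl GR] by (auto simp: left_noetherian_subring_def)
  then obtain F where F: "finite F" "F \<subseteq> (\<Union>i\<in>{n..}. G i)"
    "lspan R (carrier R) (\<Union>i\<in>{n..}. G i) = lspan R (carrier R) F"
    using R.finitely_spanned_by_subset[OF R.carrier_is_subring GR] by blast
  obtain N where "F \<subseteq> (\<Union>i\<in>{n..} \<inter> {..N}. G i)"
    using finite_subset_UN_bounded[OF F(1,2)] .
  moreover have "{n..} \<inter> {..N} = {n..N}"
    by auto
  ultimately have FN: "F \<subseteq> (\<Union>i\<in>{n..N}. G i)"
    by simp
  have lead: "h x \<in> additive_span S {r \<otimes>\<^bsub>S\<^esub> h f | r f i. i \<in> {n..N} \<and> r \<in> B (d - i) \<and> f \<in> G i}"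
    if d: "N + n \<le> d" and x: "x \<in> G d" for d x
  proof -
    have "x \<in> lspan R (carrier R) (\<Union>i\<in>{n..}. G i)"
      using x d by (intro subsetD[OF R.lspan_superset] GR) auto
    also have "\<dots> \<subseteq> lspan R (carrier R) (\<Union>i\<in>{n..N}. G i)"
      unfolding F(3) using FN GR by (intro R.lspan_mono) auto
    finally show ?thesis
      using sq.transport_homogeneous[of G N d x] d x by (auto simp: G_def)
  qed
  \<comment> \<open>\<open>J \<inter> ?U\<close> is a module over \<open>B 0\<close> inside a
    finitely generated one. Its generators over \<open>B 0\<close> turn out to generate
    \<open>J\<close> over all of \<open>S\<close>.\<close>
  let ?U = "S.below (Suc (N + n))"
  have U: "left_submodule S (B 0) (J \<inter> ?U)"
    using J S.left_submodule_below[of "Suc (N + n)"] S.additive_subgroup_Int S.component_carrier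
    by (auto simp: left_submodule_def)
  obtain E where "finite E" "E \<subseteq> carrier S" "?U \<subseteq> lspan S (B 0) E"
    using S.below_subset_lspan[OF components] .
  then have "finitely_spanned S (B 0) (J \<inter> ?U)"
    using U by (intro S.finitely_spanned_submodule[OF S.subring_component_zero noeth_zero]) auto
  then obtain T where T: "finite T" "T \<subseteq> carrier S" "J \<inter> ?U = lspan S (B 0) T"
    by (auto simp: finitely_spanned_def)
  let ?W = "lspan S (carrier S) T"
  have W: "left_submodule S (carrier S) ?W" and Wadd: "additive_subgroup ?W S"
    using S.lspan_submodule[OF S.carrier_is_subring T(2)] by (auto simp: left_submodule_def)
  have "T \<subseteq> J"
    using T S.lspan_superset[OF S.one_in_component_zero T(2)] by auto
  then have WJ: "?W \<subseteq> J"
    by (rule S.lspan_least[OF J])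
  have UW: "J \<inter> ?U \<subseteq> ?W"
    unfolding T(3) using T(2) S.component_subset by (intro S.lspan_mono) auto
  \<comment> \<open>Induction on the degree: up to \<open>N + n\<close> the claim is
    \<open>UW\<close>, and beyond that the leading form is cancelled by an element of
    \<open>?W\<close>.\<close>
  have "J \<inter> S.below d \<subseteq> ?W" for d
  proof (induction d)
    case 0
    then show ?case
      using UW S.below_mono[of 0 "Suc (N + n)"] by auto
  next
    case (Suc d)
    show ?case
    proof (cases "d \<le> N + n")
      case True
      then show ?thesis
        using UW S.below_mono[of "Suc d" "Suc (N + n)"] by auto
    next
      case False
      then have d: "N + n \<le> d" "n \<le> d"
        by simp_all
      show ?thesis
      proof
        fix y assume y: "y \<in> J \<inter> S.below (Suc d)"
        then have yS: "y \<in> carrier S"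
          using JS by auto
        \<comment> \<open>Components of degree \<open>d\<close> of elements of \<open>?W\<close> of
          degree at most \<open>d\<close>. The aim is to find the component of \<open>y\<close>
          among them.\<close>
        let ?H = "{x \<in> carrier S. \<exists>z\<in>?W \<inter> S.below (Suc d). S.hc d z = x}"
        have WU: "additive_subgroup (?W \<inter> S.below (Suc d)) S"
          by (intro S.additive_subgroup_Int Wadd S.below_subgroup)
        have WUc: "z \<in> carrier S" if "z \<in> ?W \<inter> S.below (Suc d)" for z
          using additive_subgroup.a_Hcarr[OF WU that] .
        have H: "additive_subgroup ?H S"
        proof (rule S.additive_subgroupI')
          show "\<zero>\<^bsub>S\<^esub> \<in> ?H"
            using additive_subgroup.zero_closed[OF WU]
            by (intro CollectI conjI bexI[of _ "\<zero>\<^bsub>S\<^esub>"]) auto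
        next
          fix x x' assume "x \<in> ?H" "x' \<in> ?H"
          then obtain z z' where z: "z \<in> ?W \<inter> S.below (Suc d)" "x = S.hc d z"
            and z': "z' \<in> ?W \<inter> S.below (Suc d)" "x' = S.hc d z'"
            by blast
          then show "x \<oplus>\<^bsub>S\<^esub> x' \<in> ?H"
            using additive_subgroup.a_closed[OF WU z(1) z'(1)] WUc[OF z(1)] WUc[OF z'(1)]
            by (intro CollectI conjI bexI[of _ "z \<oplus>\<^bsub>S\<^esub> z'"]) (auto simp: S.hcomp_add)
        next
          fix x assume "x \<in> ?H"
          then obtain z where z: "z \<in> ?W \<inter> S.below (Suc d)" "x = S.hc d z"
            by blast
          then show "\<ominus>\<^bsub>S\<^esub> x \<in> ?H"
            using additive_subgroup.a_inv_closed[OF WU z(1)] WUc[OF z(1)]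
            by (intro CollectI conjI bexI[of _ "\<ominus>\<^bsub>S\<^esub> z"]) (auto simp: S.hcomp_a_inv)
        qed auto
        have "S.hc d y \<in> B d"
          using yS by (rule S.hcomp_mem)
        then have x: "iso_inv (S.hc d y) \<in> A d" "h (iso_inv (S.hc d y)) = S.hc d y"
          using d iso_inv_component iso_iso_inv S.component_subset_tail[OF d(2)] by auto
        have "iso_inv (S.hc d y) \<in> G d"
          using x y unfolding G_def lead_def by (intro CollectI conjI) auto
        from lead[OF d(1) this] have "S.hc d y \<in> additive_span S
            {r \<otimes>\<^bsub>S\<^esub> h f | r f i. i \<in> {n..N} \<and> r \<in> B (d - i) \<and> f \<in> G i}"
          unfolding x(2) .
        also have "\<dots> \<subseteq> ?H"
        proof (rule S.additive_span_least[OF H], rule subsetI)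
          fix v assume "v \<in> {r \<otimes>\<^bsub>S\<^esub> h f | r f i. i \<in> {n..N} \<and> r \<in> B (d - i) \<and> f \<in> G i}"
          then obtain r f i where v: "v = r \<otimes>\<^bsub>S\<^esub> h f" and i: "n \<le> i" "i \<le> N"
            and r: "r \<in> B (d - i)" and f: "f \<in> G i"
            by auto
          \<comment> \<open>\<open>h f\<close> is the component of degree \<open>i\<close> of some
            \<open>y'\<close> in \<open>J\<close> of degree at most \<open>i\<close>. Since
            \<open>i\<close> is at most \<open>N\<close>, \<open>y'\<close> lies in
            \<open>?U\<close>, and \<open>r\<close> times \<open>y'\<close> realizes
            \<open>v\<close> in degree \<open>d\<close>.\<close>
          obtain y' where y': "y' \<in> J \<inter> S.below (Suc i)" "h f = S.hc i y'"
            using f by (auto simp: G_def lead_def)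
          have "y' \<in> ?W"
            using UW y' i S.below_mono[of "Suc i" "Suc (N + n)"] by auto
          then have z: "r \<otimes>\<^bsub>S\<^esub> y' \<in> ?W"
            using W r S.component_carrier by (auto simp: left_submodule_def)
          have "d - i + i = d"
            using i d by simp
          then have "r \<otimes>\<^bsub>S\<^esub> y' \<in> S.below (Suc d)" "S.hc d (r \<otimes>\<^bsub>S\<^esub> y') = v"
            using S.hcomp_mult_below[OF r, of y' i] y' v by auto
          then show "v \<in> ?H"
            using z S.below_iff S.hcomp_carrier
            by (intro CollectI conjI bexI[of _ "r \<otimes>\<^bsub>S\<^esub> y'"]) auto
        qed
        finally obtain z where z: "z \<in> ?W" "z \<in> S.below (Suc d)" "S.hc d z = S.hc d y"
          by blast
        have zS: "z \<in> carrier S"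
          using z(2) by (simp add: S.below_iff)
        \<comment> \<open>\<open>y\<close> and \<open>z\<close> agree in degree \<open>d\<close> and
          vanish above it, so their difference falls under the induction hypothesis.\<close>
        have "S.hc i (y \<ominus>\<^bsub>S\<^esub> z) = \<zero>\<^bsub>S\<^esub>" if "d \<le> i" for i
        proof -
          have "S.hc i y = S.hc i z"
            using y z that by (cases "i = d") (auto simp: S.below_iff)
          then show ?thesis
            using yS zS by (simp add: S.hcomp_minus)
        qed
        then have "y \<ominus>\<^bsub>S\<^esub> z \<in> S.below d"
          using yS zS by (simp add: S.below_iff)
        moreover have "y \<ominus>\<^bsub>S\<^esub> z \<in> J"
          using y z(1) WJ by (intro S.additive_subgroup_minus[OF Jadd]) auto
        ultimately have "y \<ominus>\<^bsub>S\<^esub> z \<in> ?W"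
          using Suc.IH by auto
        then have "(y \<ominus>\<^bsub>S\<^esub> z) \<oplus>\<^bsub>S\<^esub> z \<in> ?W"
          using z(1) additive_subgroup.a_closed[OF Wadd] by simp
        moreover have "(y \<ominus>\<^bsub>S\<^esub> z) \<oplus>\<^bsub>S\<^esub> z = y"
          using yS zS by (simp add: a_minus_def S.a_assoc S.l_neg)
        ultimately show "y \<in> ?W"
          by simp
      qed
    qed
  qed
  then have "J \<subseteq> ?W"
    using JS S.ex_below by blast
  then show "finitely_spanned S (carrier S) J"
    unfolding finitely_spanned_def using WJ T(1,2) by (intro exI[of _ T]) auto
qed

text \<open>Two bounds enter: \<open>N1\<close> for homogeneous generators of \<open>M\<close>, and
  \<open>N2\<close> for homogeneous generators of the left ideal spanned by the components of degree
  at least \<open>n\<close>. A coefficient of degree at least \<open>n\<close> is a sum of products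
  \<open>c x\<close> with \<open>x\<close> among the latter. Then \<open>(c x) f = c (x f)\<close>,
  where \<open>x f\<close> has degree between \<open>n\<close> and \<open>N1 + N2\<close>; so in
  high degrees \<open>M\<close> is generated by elements to which \<psi> applies.\<close>

lemma (in graded_tail_square) finitely_spanned_transfer:
  assumes noeth: "left_noetherian_subring R (carrier R)"
    and fg: "finitely_spanned M src.image_ring (carrier M)"
    and components: "\<And>i. finitely_spanned M' (\<theta>' ` A' 0) (B' i)"
  shows "finitely_spanned M' tgt.image_ring (carrier M')"
proof -
  let ?C = src.image_ring
  have "carrier M \<subseteq> lspan M ?C (\<Union>i\<in>UNIV. B i)"
  proof (rule src.M.carrier_subset_if_homogeneous)
    show "additive_subgroup (lspan M ?C (\<Union>i\<in>UNIV. B i)) M"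
      using src.M.component_carrier by (intro src.M.lspan_subgroup) auto
    show "B i \<subseteq> lspan M ?C (\<Union>i\<in>UNIV. B i)" for i
      using src.M.lspan_superset[OF subringE(3)[OF src.subring_image], of "\<Union>i\<in>UNIV. B i"]
        src.M.component_carrier by blast
  qed
  then have carr: "carrier M = lspan M ?C (\<Union>i\<in>UNIV. B i)"
    using src.M.lspan_carrier[OF src.image_subset, of "\<Union>i\<in>UNIV. B i"]
      src.M.component_carrier by blast
  have BM: "(\<Union>i\<in>UNIV. B i) \<subseteq> carrier M"
    using src.M.component_carrier by auto
  obtain F where F: "finite F" "F \<subseteq> (\<Union>i\<in>UNIV. B i)"
    "lspan M ?C (\<Union>i\<in>UNIV. B i) = lspan M ?C F"
    using src.M.finitely_spanned_by_subset[OF src.subring_image BM fg[unfolded carr]] .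
  obtain N1 where N1: "F \<subseteq> (\<Union>i\<in>UNIV \<inter> {..N1}. B i)"
    using finite_subset_UN_bounded[OF F(1,2)] .
  have AR: "(\<Union>i\<in>I. A i) \<subseteq> carrier R" for I
    using src.R.component_carrier by auto
  have "left_submodule R (carrier R) (lspan R (carrier R) (\<Union>i\<in>{n..}. A i))"
    using AR by (intro src.R.lspan_submodule src.R.carrier_is_subring)
  then have "finitely_spanned R (carrier R) (lspan R (carrier R) (\<Union>i\<in>{n..}. A i))"
    using noeth src.R.lspan_carrier[OF subset_refl AR] by (auto simp: left_noetherian_subring_def)
  then obtain F2 where F2: "finite F2" "F2 \<subseteq> (\<Union>i\<in>{n..}. A i)"
    "lspan R (carrier R) (\<Union>i\<in>{n..}. A i) = lspan R (carrier R) F2"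
    using src.R.finitely_spanned_by_subset[OF src.R.carrier_is_subring AR] by blast
  obtain N2 where N2: "F2 \<subseteq> (\<Union>i\<in>{n..} \<inter> {..N2}. A i)"
    using finite_subset_UN_bounded[OF F2(1,2)] .
  let ?N = "N1 + N2"
  let ?V = "lspan M ?C (\<Union>k\<in>{n..?N}. B k)"
  have V: "left_submodule M ?C ?V" and Vadd: "additive_subgroup ?V M"
    using src.M.lspan_submodule[OF src.subring_image, of "\<Union>k\<in>{n..?N}. B k"]
      src.M.component_carrier by (auto simp: left_submodule_def)
  have generated: "B d \<subseteq> ?V" if d: "?N + n \<le> d" for d
  proof
    fix m assume m: "m \<in> B d"
    have "m \<in> lspan M ?C F"
      using m F(3) carr src.M.component_carrier by auto
    also have "\<dots> \<subseteq> lspan M ?C (\<Union>i\<in>{..N1}. B i)"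
      using N1 src.M.component_carrier by (intro src.M.lspan_mono) auto
    finally have "m \<in> additive_span M
        {\<theta> r \<otimes>\<^bsub>M\<^esub> f | r f i. i \<in> {..N1} \<and> i \<le> d \<and> r \<in> A (d - i) \<and> f \<in> B i}"
      using src.homogeneous_in_lspan[of B m d "{..N1}"] m by auto
    also have "\<dots> \<subseteq> ?V"
    proof (rule src.M.additive_span_least[OF Vadd], rule subsetI)
      fix v assume "v \<in> {\<theta> r \<otimes>\<^bsub>M\<^esub> f | r f i. i \<in> {..N1} \<and> i \<le> d \<and> r \<in> A (d - i) \<and> f \<in> B i}"
      then obtain r f i where v: "v = \<theta> r \<otimes>\<^bsub>M\<^esub> f" and i: "i \<le> N1"
        and r: "r \<in> A (d - i)" and f: "f \<in> B i"
        by auto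
      have fM: "f \<in> carrier M"
        using f by (rule src.M.component_carrier)
      \<comment> \<open>As \<open>f\<close> has degree at most \<open>N1\<close>, the coefficient
        \<open>r\<close> has degree at least \<open>n\<close> and can be expanded in the generators
        \<open>F2\<close>.\<close>
      have "n \<le> d - i"
        using i d by simp
      then have "r \<in> lspan R (carrier R) (\<Union>i\<in>{n..}. A i)"
        using r by (intro subsetD[OF src.R.lspan_superset] AR) auto
      also have "\<dots> = lspan R (carrier R) F2"
        by (rule F2(3))
      also have "\<dots> \<subseteq> {r \<in> carrier R. \<theta> r \<otimes>\<^bsub>M\<^esub> f \<in> ?V}"
      proof (rule src.R.lspan_subset)
        show "additive_subgroup {r \<in> carrier R. \<theta> r \<otimes>\<^bsub>M\<^esub> f \<in> ?V} R"
          using fM Vadd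
          by (intro src.R.additive_subgroupI')
            (auto simp: src.M.l_distr src.M.l_minus additive_subgroup.zero_closed
              additive_subgroup.a_closed additive_subgroup.a_inv_closed)
        fix c x assume c: "c \<in> carrier R" and x: "x \<in> F2"
        obtain j where j: "n \<le> j" "j \<le> N2" "x \<in> A j"
          using x N2 by auto
        have xR: "x \<in> carrier R"
          using j src.R.component_carrier by blast
        have "\<theta> x \<otimes>\<^bsub>M\<^esub> f \<in> B (j + i)"
          using j f by (intro src.M.component_mult src.hom_component)
        then have "\<theta> c \<otimes>\<^bsub>M\<^esub> (\<theta> x \<otimes>\<^bsub>M\<^esub> f) \<in> ?V"
          using c i j by (intro src.M.lspan_mult) (auto intro!: bexI[of _ "j + i"])
        then show "c \<otimes>\<^bsub>R\<^esub> x \<in> {r \<in> carrier R. \<theta> r \<otimes>\<^bsub>M\<^esub> f \<in> ?V}"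
          using c xR fM by (simp add: src.M.m_assoc)
      qed
      finally show "v \<in> ?V"
        using v by simp
    qed
    finally show "m \<in> ?V" .
  qed
  let ?C' = tgt.image_ring
  obtain g where g: "\<And>i. finite (g i) \<and> g i \<subseteq> carrier M' \<and> B' i = lspan M' (\<theta>' ` A' 0) (g i)"
    using components unfolding finitely_spanned_def by metis
  \<comment> \<open>The sets \<open>g k\<close> generate components over the image of
    \<open>A' 0\<close>; over the larger \<open>?C'\<close> their span still contains these
    components.\<close>
  let ?T = "\<Union>k\<le>?N + n. g k"
  have T: "finite ?T" "?T \<subseteq> carrier M'"
    using g by auto
  let ?W = "lspan M' ?C' ?T"
  have W: "left_submodule M' ?C' ?W" and Wadd: "additive_subgroup ?W M'"
    using tgt.M.lspan_submodule[OF tgt.subring_image T(2)] by (auto simp: left_submodule_def)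
  have small: "B' k \<subseteq> ?W" if "k \<le> ?N + n" for k
  proof -
    have "lspan M' (\<theta>' ` A' 0) (g k) \<subseteq> ?W"
      using that T(2) tgt.R.component_carrier by (intro tgt.M.lspan_mono) auto
    then show ?thesis
      using g[of k] by simp
  qed
  have "B' d \<subseteq> ?W" for d
  proof (cases "d \<le> ?N + n")
    case True
    then show ?thesis
      by (rule small)
  next
    case False
    then have d: "?N + n \<le> d" "n \<le> d"
      by simp_all
    show ?thesis
    proof
      fix y assume y: "y \<in> B' d"
      have x: "mod_iso.iso_inv y \<in> B d" "\<psi> (mod_iso.iso_inv y) = y"
        using y d mod_iso.iso_inv_component mod_iso.iso_iso_inv
          tgt.M.component_subset_tail[OF d(2)] by auto
      \<comment> \<open>In this application of the transport, the generating sets are the full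
        components of degrees \<open>n\<close> to \<open>?N\<close>.\<close>
      have "y \<in> additive_span M'
          {\<theta>' r \<otimes>\<^bsub>M'\<^esub> \<psi> f | r f i. i \<in> {n..?N} \<and> r \<in> A' (d - i) \<and> f \<in> B i}"
        using transport_homogeneous[of B ?N d "mod_iso.iso_inv y"] d x generated[OF d(1)] by auto
      also have "\<dots> \<subseteq> ?W"
      proof (rule tgt.M.additive_span_least[OF Wadd], rule subsetI)
        fix v assume "v \<in> {\<theta>' r \<otimes>\<^bsub>M'\<^esub> \<psi> f | r f i. i \<in> {n..?N} \<and> r \<in> A' (d - i) \<and> f \<in> B i}"
        then obtain r f i where v: "v = \<theta>' r \<otimes>\<^bsub>M'\<^esub> \<psi> f" and i: "n \<le> i" "i \<le> ?N"
          and r: "r \<in> A' (d - i)" and f: "f \<in> B i"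
          by auto
        have "\<psi> f \<in> ?W"
          using small[of i] mod_iso.iso_component[OF i(1) f] i by auto
        then show "v \<in> ?W"
          using v r W tgt.R.component_carrier by (auto simp: left_submodule_def)
      qed
      finally show "y \<in> ?W" .
    qed
  qed
  then have "carrier M' \<subseteq> ?W"
    by (rule tgt.M.carrier_subset_if_homogeneous[OF Wadd])
  then show ?thesis
    unfolding finitely_spanned_def using T tgt.M.lspan_carrier[OF tgt.image_subset T(2)]
    by (intro exI[of _ ?T]) auto
qed

text \<open>Compatibility at \<open>x\<close> is \<open>compat\<close> at the preimage of
  \<open>x\<close> under \<phi>, combined with the injectivity of \<psi>.\<close>

lemma (in graded_tail_square) inverse_square:
  "graded_tail_square R' A' M' B' \<theta>' R A M B \<theta> n ring_iso.iso_inv mod_iso.iso_inv"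
proof (intro graded_tail_square.intro graded_tail_square_axioms.intro)
  fix x assume x: "x \<in> tail R' A' n"
  show "mod_iso.iso_inv (\<theta>' x) = \<theta> (ring_iso.iso_inv x)"
    using compat ring_iso.iso_inv_closed[OF x] ring_iso.iso_iso_inv[OF x]
    by (intro mod_iso.iso_inv_eqI) (auto simp: src.hom_tail)
qed (rule tgt.graded_hom_axioms src.graded_hom_axioms ring_iso.graded_tail_iso_inv
    mod_iso.graded_tail_iso_inv)+

section \<open>Return to noetherian rings and finitely generated modules\<close>

lemma (in graded_hom) fin_gen_left_module_iff:
  "fin_gen_left_module R (module_via \<theta> M) \<longleftrightarrow> finitely_spanned M image_ring (carrier M)"
proof -
  have "left_submodule M image_ring (carrier M)"
    using M.additive_subgroup_carrier by (auto simp: left_submodule_def)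
  moreover have "(module_via \<theta> M)\<lparr>carrier := carrier M\<rparr> = module_via \<theta> M"
    by (simp add: module_via_def)
  ultimately show ?thesis
    using M.fin_gen_left_module_iff_finitely_spanned[OF subring_image] by metis
qed

lemma (in graded_hom) fin_gen_component_iff:
  "fin_gen_left_module (degree_zero R A) ((module_via \<theta> M)\<lparr>carrier := B i\<rparr>)
    \<longleftrightarrow> finitely_spanned M (\<theta> ` A 0) (B i)"
proof -
  have "left_submodule M (\<theta> ` A 0) (B i)"
    using M.component_subgroup M.component_mult[OF hom_component[of _ 0], of _ _ i]
    by (auto simp: left_submodule_def)
  then show ?thesis
    using M.fin_gen_left_module_iff_finitely_spanned[of \<theta> "degree_zero R A" "B i"]
      img_is_subring[OF R.subring_component_zero] by simp
qed

lemma (in graded_tail_iso) left_noetherian_if_left_noetherian: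
  assumes "left_noetherian R" "left_noetherian (degree_zero S B)"
    and "\<And>i. fin_gen_left_module (degree_zero S B) ((left_regular S)\<lparr>carrier := B i\<rparr>)"
  shows "left_noetherian S"
  using left_noetherian_transfer assms
  by (simp add: R.left_noetherian_iff S.left_noetherian_iff S.left_noetherian_component_zero
      S.fin_gen_degree_zero_iff[OF S.left_submodule_component])

lemma (in graded_tail_iso) noetherian_if_noetherian:
  assumes "noetherian R" "noetherian (degree_zero S B)"
    and "\<And>i. fin_gen_left_module (degree_zero S B) ((left_regular S)\<lparr>carrier := B i\<rparr>)"
    and "\<And>i. fin_gen_left_module (opposite_ring (degree_zero S B))
               ((left_regular (opposite_ring S))\<lparr>carrier := B i\<rparr>)"
  shows "noetherian S"
proof -
  interpret op: graded_tail_iso "opposite_ring R" A "opposite_ring S" B n h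
    by (rule graded_tail_iso_opposite)
  show ?thesis
    using assms left_noetherian_if_left_noetherian op.left_noetherian_if_left_noetherian
    by (simp add: noetherian_def opposite_ring_degree_zero)
qed

lemma (in graded_tail_square) noetherian_finitely_generated_transfer:
  assumes "noetherian (degree_zero R' A')"
    and "\<And>i. fin_gen_left_module (degree_zero R' A') ((left_regular R')\<lparr>carrier := A' i\<rparr>)"
    and "\<And>i. fin_gen_left_module (opposite_ring (degree_zero R' A'))
               ((left_regular (opposite_ring R'))\<lparr>carrier := A' i\<rparr>)"
    and "\<And>i. fin_gen_left_module (degree_zero R' A') ((module_via \<theta>' M')\<lparr>carrier := B' i\<rparr>)"
    and R: "noetherian R" and M: "fin_gen_left_module R (module_via \<theta> M)"
  shows "noetherian R' \<and> fin_gen_left_module R' (module_via \<theta>' M')"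
proof
  show "noetherian R'"
    by (rule ring_iso.noetherian_if_noetherian) (rule assms)+
  have "left_noetherian_subring R (carrier R)"
    using R by (simp add: noetherian_def src.R.left_noetherian_iff)
  then show "fin_gen_left_module R' (module_via \<theta>' M')"
    using M assms(4) unfolding src.fin_gen_left_module_iff tgt.fin_gen_left_module_iff
      tgt.fin_gen_component_iff by (rule finitely_spanned_transfer)
qed

theorem proposition6p3:
  fixes R :: "('a, 'k) ring_scheme" and A :: "nat \<Rightarrow> 'a set"
    and M :: "('b, 'l) ring_scheme" and B :: "nat \<Rightarrow> 'b set"
    and \<theta> :: "'a \<Rightarrow> 'b"
    and R' :: "('c, 'm) ring_scheme" and A' :: "nat \<Rightarrow> 'c set"
    and M' :: "('d, 'n) ring_scheme" and B' :: "nat \<Rightarrow> 'd set"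
    and \<theta>' :: "'c \<Rightarrow> 'd"
    and n :: nat and \<phi> :: "'a \<Rightarrow> 'c" and \<psi> :: "'b \<Rightarrow> 'd"
  assumes "graded_ring R A" and "graded_ring M B"
    and "\<theta> \<in> graded_ring_hom R A M B"
    and "noetherian (degree_zero R A)"
    and "\<And>i. fin_gen_left_module (degree_zero R A) ((left_regular R)\<lparr>carrier := A i\<rparr>)"
    and "\<And>i. fin_gen_left_module (opposite_ring (degree_zero R A))
               ((left_regular (opposite_ring R))\<lparr>carrier := A i\<rparr>)"
    and "\<And>i. fin_gen_left_module (degree_zero R A) ((module_via \<theta> M)\<lparr>carrier := B i\<rparr>)"
    and "graded_ring R' A'" and "graded_ring M' B'"
    and "\<theta>' \<in> graded_ring_hom R' A' M' B'"
    and "noetherian (degree_zero R' A')"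
    and "\<And>i. fin_gen_left_module (degree_zero R' A') ((left_regular R')\<lparr>carrier := A' i\<rparr>)"
    and "\<And>i. fin_gen_left_module (opposite_ring (degree_zero R' A'))
               ((left_regular (opposite_ring R'))\<lparr>carrier := A' i\<rparr>)"
    and "\<And>i. fin_gen_left_module (degree_zero R' A') ((module_via \<theta>' M')\<lparr>carrier := B' i\<rparr>)"
    and "\<phi> \<in> graded_rng_iso (tail_rng R A n) (tail_component R A n)
                             (tail_rng R' A' n) (tail_component R' A' n)"
    and "\<psi> \<in> graded_rng_iso (tail_rng M B n) (tail_component M B n)
                             (tail_rng M' B' n) (tail_component M' B' n)"
    and "\<And>x. x \<in> tail R A n \<Longrightarrow> \<psi> (\<theta> x) = \<theta>' (\<phi> x)"
  shows "noetherian R \<and> fin_gen_left_module R (module_via \<theta> M) \<longleftrightarrow>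
         noetherian R' \<and> fin_gen_left_module R' (module_via \<theta>' M')"
proof -
  interpret sq: graded_tail_square R A M B \<theta> R' A' M' B' \<theta>' n \<phi> \<psi>
    by (intro graded_tail_square.intro graded_hom.intro graded_tail_iso.intro
        graded_hom_axioms.intro graded_tail_iso_axioms.intro graded_tail_square_axioms.intro assms)
  interpret inv: graded_tail_square R' A' M' B' \<theta>' R A M B \<theta> n
      sq.ring_iso.iso_inv sq.mod_iso.iso_inv
    by (rule sq.inverse_square)
  show ?thesis
    using sq.noetherian_finitely_generated_transfer[OF assms(11-14)]
      inv.noetherian_finitely_generated_transfer[OF assms(4-7)] by blast
qed

end
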